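(* Let $p$ be an odd prime and let $B$ be a non-empty subset of $\mathbb Z_p$. (i) If $p\equiv 1\pmod 4$ and $0\notin B$, then $C_{Q_p,B}=6$. (ii) If $p\equiv 3\pmod 4$ and $B\subseteq Q_p$, then $C_{Q_p,B}=9$.
   Context: For an odd prime $p$, $\mathbb Z_p=\mathbb Z/p\mathbb Z$, $U(p)$ is its group of units, and $Q_p=\{x^2:x\in U(p)\}$. A sequence of length $k$ in $\mathbb Z_p$ is an element of $\mathbb Z_p^k$. For a non-empty $B\subseteq\mathbb Z_p$, a sequence $(x_1,\ldots,x_k)$ in $\mathbb Z_p$ is called a $(Q_p,B)$-weighted zero-sum sequence if there exist $a_1,\ldots,a_k\in Q_p$ and $b_1,\ldots,b_k\in B$ such that $a_1x_1+\cdots+a_kx_k=0$ and $b_1a_1+\cdots+b_ka_k=0$ in $\mathbb Z_p$. The constant $C_{Q_p,B}$ is the least positive integer $k$ such that every sequence in $\mathbb Z_p$ of length $k$ has a (non-empty) $(Q_p,B)$-weighted zero-sum subsequence consisting of consecutive terms. *)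

theory Defs
  imports
    "HOL-Number_Theory.Number_Theory"
    "HOL-Library.Sublist"
    "HOL-Library.Extended_Nat"
begin

abbreviation Zp :: "nat \<Rightarrow> int ring" where
  "Zp p \<equiv> residue_ring (int p)"

definition unit_squares :: "nat \<Rightarrow> int set" where
  "unit_squares p = {x [^]\<^bsub>Zp p\<^esub> (2::nat) | x. x \<in> Units (Zp p)}"

text \<open>Sequences are lists over the carrier. The same weights \<open>as\<close> occur in both equations.\<close>

definition weighted_zero_sum :: "nat \<Rightarrow> int set \<Rightarrow> int set \<Rightarrow> int list \<Rightarrow> bool" where
  "weighted_zero_sum p A B xs \<longleftrightarrow>
     (\<exists>as bs. length as = length xs \<and> length bs = length xs \<and> set as \<subseteq> A \<and> set bs \<subseteq> B \<and>
        (\<Oplus>\<^bsub>Zp p\<^esub>i\<in>{..<length xs}. as ! i \<otimes>\<^bsub>Zp p\<^esub> xs ! i) = \<zero>\<^bsub>Zp p\<^esub> \<and>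
        (\<Oplus>\<^bsub>Zp p\<^esub>i\<in>{..<length xs}. bs ! i \<otimes>\<^bsub>Zp p\<^esub> as ! i) = \<zero>\<^bsub>Zp p\<^esub>)"

text \<open>The infimum is taken in \<^typ>\<open>enat\<close>: it is the least such \<open>k\<close> if there is one and
  \<open>\<infinity>\<close> otherwise, so an equation with a numeral includes the existence of such a \<open>k\<close>.
  \<^const>\<open>sublist\<close> is the relation of being a contiguous block.\<close>

definition C_const :: "nat \<Rightarrow> int set \<Rightarrow> int set \<Rightarrow> enat" where
  "C_const p A B = Inf {enat k | k. 0 < k \<and>
     (\<forall>xs. length xs = k \<and> set xs \<subseteq> carrier (Zp p) \<longrightarrow>
        (\<exists>ys. ys \<noteq> [] \<and> sublist ys xs \<and> weighted_zero_sum p A B ys))}"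

end

theory Submission
  imports Defs "HOL-Analysis.Convex"
begin

text \<open>
  For the upper bounds it suffices to find square weights \<open>a\<^sub>i\<close> with \<open>\<Sum> a\<^sub>i = 0\<close> and
  \<open>\<Sum> a\<^sub>i x\<^sub>i = 0\<close>, by taking all \<open>b\<^sub>i\<close> equal. Two equal neighbours (if -1 is a square) or three
  equal neighbours (if it is not and \<open>p > 3\<close>) form such a block, so long runs can be excluded.
  Then, if some value occurs at least three times, at least three terms differ from it. These are
  balanced first, and three equal terms can absorb any total. If every value occurs at most twice,
  six consecutive terms split into two triples of distinct values. A collision count with the
  Cauchy--Schwarz inequality shows that the square combinations of the vectors \<open>(1, x\<^sub>i)\<close> of a triple
  fill more than half of the plane as soon as \<open>p \<ge> 11\<close>, so the two triples can be made to cancel.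
  The remaining cases for the primes 3, 5 and 7 are treated separately. The lower bounds come from
  \<open>(0, 1, 0, g, 0)\<close> with a nonresidue \<open>g\<close> and from \<open>(0, 0, 1, 0, 0, 1, 0, 0)\<close>.
\<close>

subsection \<open>Counting differences of squares\<close>

text \<open>The collisions number the sum of the squares of the fibre sizes of \<open>f\<close>, and
  the fibre sizes add up to \<open>card A\<close>, so Cauchy--Schwarz over the fibres gives the
  bound. Few collisions thus force a large image.\<close>

lemma card_power2_le_image_collisions:
  assumes "finite A"
  shows "(card A)\<^sup>2 \<le> card (f ` A) * card {(s, t). s \<in> A \<and> t \<in> A \<and> f s = f t}"
proof -
  define F where "F y = {s \<in> A. f s = y}" for y
  have fin: "finite (F y)" for y
    using assms by (simp add: F_def)
  have "card A = card (\<Union>y\<in>f ` A. F y)"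
    by (rule arg_cong[where f = card]) (auto simp: F_def)
  also have "\<dots> = (\<Sum>y\<in>f ` A. card (F y))"
    by (rule card_UN_disjoint) (use assms fin in \<open>auto simp: F_def\<close>)
  finally have A: "card A = (\<Sum>y\<in>f ` A. card (F y))" .
  have "card {(s, t). s \<in> A \<and> t \<in> A \<and> f s = f t} = card (\<Union>y\<in>f ` A. F y \<times> F y)"
    by (rule arg_cong[where f = card]) (auto simp: F_def)
  also have "\<dots> = (\<Sum>y\<in>f ` A. card (F y \<times> F y))"
    by (rule card_UN_disjoint) (use assms fin in \<open>auto simp: F_def\<close>)
  finally have C: "card {(s, t). s \<in> A \<and> t \<in> A \<and> f s = f t} = (\<Sum>y\<in>f ` A. (card (F y))\<^sup>2)"
    by (simp add: card_cartesian_product power2_eq_square)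
  have "(\<Sum>y\<in>f ` A. real (card (F y)))\<^sup>2 \<le> (\<Sum>y\<in>f ` A. (real (card (F y)))\<^sup>2) * real (card (f ` A))"
    by (rule sum_squared_le_sum_of_squares) 
  then have "real ((card A)\<^sup>2)
      \<le> real (card (f ` A) * card {(s, t). s \<in> A \<and> t \<in> A \<and> f s = f t})"
    unfolding A C by (simp add: mult.commute)
  then show ?thesis
    by (simp only: of_nat_le_iff)
qed

text \<open>Lets weights kept in a multiset of pairs be listed in the order of a given
  sequence.\<close>

lemma image_mset_eq_mset_map:
  assumes "image_mset f W = mset xs"
  shows "\<exists>ws. mset ws = W \<and> map f ws = xs"
  using assms
proof (induction xs arbitrary: W)
  case (Cons x xs)
  then obtain W' w where W: "W = add_mset w W'" "f w = x" "image_mset f W' = mset xs"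
    by (metis msed_map_invR mset.simps(2))
  then obtain ws where "mset ws = W'" "map f ws = xs"
    using Cons.IH by blast
  then show ?case
    using W by (intro exI[of _ "w # ws"]) simp
qed simp

section \<open>Squares modulo an odd prime\<close>

locale odd_prime_mod =
  fixes p :: int
  assumes prime: "prime p" and gt_2: "p > 2"
begin

text \<open>Taken on all integers, so that products and negatives need no reduction;
  \<open>Q\<close> holds the reduced representatives, over which counting takes place.\<close>

definition sq :: "int \<Rightarrow> bool" where
  "sq a \<longleftrightarrow> (\<exists>y. \<not> p dvd y \<and> [a = y\<^sup>2] (mod p))"

definition Q :: "int set" where
  "Q = {a \<in> {0..<p}. sq a}"

lemma dvd_mult_iff: "p dvd a * b \<longleftrightarrow> p dvd a \<or> p dvd b"
  using prime by (simp add: prime_dvd_mult_iff)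

lemma not_dvd_2: "\<not> p dvd 2"
  using gt_2 by (auto dest: zdvd_imp_le)

lemma not_dvd_1: "\<not> p dvd 1"
  using gt_2 by simp

lemma dvd_diff_eq:
  assumes "p dvd a - b" "a \<in> {0..<p}" "b \<in> {0..<p}"
  shows "a = b"
  using assms by (auto simp: mod_eq_dvd_iff[symmetric])

lemma inverse_mod:
  assumes "\<not> p dvd a"
  obtains i where "p dvd a * i - 1" "\<not> p dvd i"
proof -
  have "coprime a p"
    using prime assms by (metis coprime_commute prime_imp_coprime)
  then obtain i where i: "[a * i = 1] (mod p)"
    using cong_solve_coprime_int by blast
  then have "p dvd a * i - 1"
    by (simp add: cong_iff_dvd_diff)
  moreover have "\<not> p dvd i"
    using i by (metis cong_dvd_iff dvd_mult not_dvd_1)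
  ultimately show ?thesis
    using that by blast
qed

lemma sq_cong: "[a = b] (mod p) \<Longrightarrow> sq a \<longleftrightarrow> sq b"
  by (auto simp: sq_def cong_def)

lemma sq_mod [simp]: "sq (a mod p) \<longleftrightarrow> sq a"
  by (rule sq_cong) (simp add: cong_def)

lemma sq_1 [simp]: "sq 1"
  unfolding sq_def by (rule exI[of _ 1]) (use gt_2 in simp)

lemma sq_not_dvd: "sq a \<Longrightarrow> \<not> p dvd a"
  by (auto simp: sq_def cong_dvd_iff prime_dvd_power_iff prime)

lemma sq_mult: "sq a \<Longrightarrow> sq b \<Longrightarrow> sq (a * b)"
  unfolding sq_def by (metis cong_mult dvd_mult_iff power_mult_distrib)

text \<open>If \<open>y\<close> is a root of \<open>a\<close> and \<open>z\<close> a root of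
  \<open>a * b\<close>, then \<open>z\<close> times an inverse of \<open>y\<close> is a root of
  \<open>b\<close>.\<close>

lemma sq_cancel:
  assumes "sq a" "sq (a * b)"
  shows "sq b"
proof -
  obtain y where y: "\<not> p dvd y" "[a = y\<^sup>2] (mod p)"
    using assms(1) by (auto simp: sq_def)
  obtain z where z: "\<not> p dvd z" "[a * b = z\<^sup>2] (mod p)"
    using assms(2) by (auto simp: sq_def)
  obtain i where i: "p dvd y * i - 1" "\<not> p dvd i"
    using inverse_mod y(1) by blast
  have i1: "[i * y = 1] (mod p)"
    using i by (simp add: cong_iff_dvd_diff mult.commute)
  have "[b = b * (i * y)\<^sup>2] (mod p)"
    using cong_mult[OF cong_refl cong_pow[OF i1, of 2], of b] by (simp add: cong_sym)
  also have "b * (i * y)\<^sup>2 = y\<^sup>2 * (b * i\<^sup>2)"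
    by (simp add: power_mult_distrib)
  also have "[y\<^sup>2 * (b * i\<^sup>2) = a * (b * i\<^sup>2)] (mod p)"
    by (rule cong_mult[OF cong_sym[OF y(2)] cong_refl])
  also have "a * (b * i\<^sup>2) = a * b * i\<^sup>2"
    by simp
  also have "[a * b * i\<^sup>2 = z\<^sup>2 * i\<^sup>2] (mod p)"
    by (rule cong_mult[OF z(2) cong_refl])
  also have "z\<^sup>2 * i\<^sup>2 = (z * i)\<^sup>2"
    by (simp add: power_mult_distrib)
  finally show ?thesis
    unfolding sq_def using z(1) i(2) dvd_mult_iff by blast
qed

lemma finite_Q [simp]: "finite Q"
  by (rule finite_subset[of _ "{0..<p}"]) (auto simp: Q_def)

text \<open>Squaring maps \<open>{1..p div 2}\<close> bijectively onto \<open>Q\<close>: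
  \<open>x\<close> and \<open>p - x\<close> have the same square, and a square has no further
  roots.\<close>

lemma p_eq: "p = 2 * int (card Q) + 1"
proof -
  have odd: "odd p"
    using prime gt_2 by (rule prime_odd_int)
  have "bij_betw (\<lambda>x. x\<^sup>2 mod p) {1..p div 2} Q"
  proof (rule bij_betw_imageI)
    show "inj_on (\<lambda>x. x\<^sup>2 mod p) {1..p div 2}"
    proof (rule inj_onI)
      fix x y assume xy: "x \<in> {1..p div 2}" "y \<in> {1..p div 2}" "x\<^sup>2 mod p = y\<^sup>2 mod p"
      have "p dvd x\<^sup>2 - y\<^sup>2"
        using xy(3) by (simp add: mod_eq_dvd_iff)
      then have "p dvd (x - y) * (x + y)"
        by (simp add: algebra_simps power2_eq_square)
      moreover have "\<not> p dvd x + y"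
        using xy(1,2) odd by (auto dest!: zdvd_imp_le elim!: oddE)
      ultimately have "p dvd x - y"
        by (simp add: dvd_mult_iff)
      then show "x = y"
        by (rule dvd_diff_eq) (use xy gt_2 in auto)
    qed
    show "(\<lambda>x. x\<^sup>2 mod p) ` {1..p div 2} = Q"
    proof (intro equalityI subsetI)
      fix a assume "a \<in> (\<lambda>x. x\<^sup>2 mod p) ` {1..p div 2}"
      then obtain x where x: "x \<in> {1..p div 2}" "a = x\<^sup>2 mod p"
        by blast
      have "\<not> p dvd x"
        using x(1) gt_2 by (auto dest!: zdvd_imp_le)
      then have "sq a"
        using x(2) unfolding sq_def by (intro exI[of _ x]) (simp add: cong_def)
      then show "a \<in> Q"
        using x(2) gt_2 by (simp add: Q_def)
    next
      fix a assume "a \<in> Q"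
      then obtain y where y: "a \<in> {0..<p}" "\<not> p dvd y" "[a = y\<^sup>2] (mod p)"
        by (auto simp: Q_def sq_def)
      define x where "x = y mod p"
      have x: "0 < x" "x < p" "a = x\<^sup>2 mod p"
        using y gt_2 by (auto simp: x_def cong_def power_mod dvd_eq_mod_eq_0 order.not_eq_order_implies_strict)
      show "a \<in> (\<lambda>x. x\<^sup>2 mod p) ` {1..p div 2}"
      proof (cases "x \<le> p div 2")
        case True
        then show ?thesis
          using x by auto
      next
        case False
        have "(p - x)\<^sup>2 mod p = a"
          by (simp add: x(3) mod_eq_dvd_iff power2_eq_square algebra_simps)
        then show ?thesis
          using x False odd by (intro image_eqI[of _ _ "p - x"]) (auto elim!: oddE)
      qed
    qed
  qed
  then have "card {1..p div 2} = card Q"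
    by (rule bij_betw_same_card)
  then show ?thesis
    using odd gt_2 by (auto elim!: oddE)
qed

section \<open>Representations of a residue as a difference of two squares\<close>

definition sq_diff :: "int \<Rightarrow> (int \<times> int) set" where
  "sq_diff d = {(a, b). a \<in> Q \<and> b \<in> Q \<and> p dvd a - b - d}"

lemma finite_sq_diff [simp]: "finite (sq_diff d)"
  by (rule finite_subset[of _ "Q \<times> Q"]) (auto simp: sq_diff_def)

text \<open>The first square determines the second. This trivial bound serves the diagonal case
  \<open>d = 0\<close> of the counts below.\<close>

lemma card_sq_diff_le: "card (sq_diff d) \<le> card Q"
proof (rule card_inj_on_le[where f = fst])
  show "inj_on fst (sq_diff d)"
  proof (rule inj_onI, clarify)
    fix a b a' b' assume *: "(a, b) \<in> sq_diff d" "(a', b') \<in> sq_diff d" "fst (a, b) = fst (a', b')"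
    then have "p dvd b - b'"
      using dvd_diff[of p "a - b' - d" "a - b - d"] by (simp add: sq_diff_def)
    then have "b = b'"
      by (rule dvd_diff_eq) (use * in \<open>auto simp: sq_diff_def Q_def\<close>)
    then show "a = a' \<and> b = b'"
      using * by simp
  qed
qed (auto simp: sq_diff_def)

text \<open>Writing \<open>a = x\<^sup>2\<close> and \<open>b = y\<^sup>2\<close>, a representation \<open>d = a - b = (x + y) * (x - y)\<close> gives four
  nonzero residues \<open>\<plusminus>x \<plusminus> y\<close>, and each of them determines the representation.\<close>

lemma card_sq_diff:
  assumes "\<not> p dvd d"
  shows "2 * card (sq_diff d) \<le> card Q"
proof -
  \<comment> \<open>\<open>u\<close> and \<open>v\<close> run over all square roots, so
    \<open>T r\<close> involves no choice of roots.\<close>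
  define T where "T r = {(u + v) mod p | u v. [fst r = u\<^sup>2] (mod p) \<and> [snd r = v\<^sup>2] (mod p)}" for r
  have T_card: "4 \<le> card (T r) \<and> T r \<subseteq> {1..<p}" if r_in: "r \<in> sq_diff d" for r
  proof -
    obtain a b where r: "r = (a, b)" "sq a" "sq b" "p dvd a - b - d"
      using r_in unfolding sq_diff_def Q_def by blast
    obtain x y where xy: "\<not> p dvd x" "[a = x\<^sup>2] (mod p)" "\<not> p dvd y" "[b = y\<^sup>2] (mod p)"
      using r by (auto simp: sq_def)
    have nz: "\<not> p dvd u + v" if "[a = u\<^sup>2] (mod p)" "[b = v\<^sup>2] (mod p)" for u v
    proof
      assume "p dvd u + v"
      then have "p dvd (u + v) * (u - v)"
        by simp
      moreover have "[a - b = u\<^sup>2 - v\<^sup>2] (mod p)"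
        using that by (rule cong_diff)
      ultimately have "p dvd a - b"
        by (simp add: cong_dvd_iff power2_eq_square algebra_simps)
      then have "p dvd (a - b) - (a - b - d)"
        using r(4) by (rule dvd_diff)
      then show False
        using assms by simp
    qed
    have sub: "T r \<subseteq> {1..<p}"
    proof
      fix t assume "t \<in> T r"
      then obtain u v where uv: "t = (u + v) mod p" "[a = u\<^sup>2] (mod p)" "[b = v\<^sup>2] (mod p)"
        unfolding T_def r by auto
      have "t \<noteq> 0" "0 \<le> t" "t < p"
        using nz[OF uv(2,3)] gt_2 by (simp_all add: uv(1) dvd_eq_mod_eq_0)
      then show "t \<in> {1..<p}"
        by simp
    qed
    have T_I: "(u + v) mod p \<in> T r" if "u\<^sup>2 = x\<^sup>2" "v\<^sup>2 = y\<^sup>2" for u v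
      using xy that unfolding T_def r by force
    have four: "{(x + y) mod p, (x + - y) mod p, (- x + y) mod p, (- x + - y) mod p} \<subseteq> T r"
      by (simp only: insert_subset) (intro conjI T_I; simp)
    have nd: "\<not> p dvd 2 * x" "\<not> p dvd 2 * y" "\<not> p dvd 2 * (x + y)" "\<not> p dvd 2 * (x - y)"
      unfolding dvd_mult_iff using xy nz[of x y] nz[of x "- y"] not_dvd_2 by simp_all
    have neq: "s mod p \<noteq> t mod p" if "s - t = c \<or> s - t = - c" "\<not> p dvd c" for s t c
      using that by (auto simp only: mod_eq_dvd_iff dvd_minus_iff)
    have "(x + y) mod p \<noteq> (x + - y) mod p" "(- x + y) mod p \<noteq> (- x + - y) mod p"
      by (rule neq[OF _ nd(2)]; simp)+
    moreover have "(x + y) mod p \<noteq> (- x + y) mod p" "(x + - y) mod p \<noteq> (- x + - y) mod p"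
      by (rule neq[OF _ nd(1)]; simp)+
    moreover have "(x + y) mod p \<noteq> (- x + - y) mod p"
      by (rule neq[OF _ nd(3)]) simp
    moreover have "(x + - y) mod p \<noteq> (- x + y) mod p"
      by (rule neq[OF _ nd(4)]) simp
    ultimately have "card {(x + y) mod p, (x + - y) mod p, (- x + y) mod p, (- x + - y) mod p} = 4"
      by (simp only: card_insert_if finite.intros insert_iff empty_iff card.empty) simp
    moreover have "finite (T r)"
      using sub by (rule finite_subset) simp
    ultimately show ?thesis
      using card_mono[OF _ four] sub by simp
  qed
  have T_disj: "T r \<inter> T s = {}" if rs: "r \<in> sq_diff d" "s \<in> sq_diff d" "r \<noteq> s" for r s
  proof (rule ccontr)
    assume "T r \<inter> T s \<noteq> {}"
    then obtain t0 where t0: "t0 \<in> T r" "t0 \<in> T s"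
      by blast
    obtain u v where uv: "t0 = (u + v) mod p" "[fst r = u\<^sup>2] (mod p)" "[snd r = v\<^sup>2] (mod p)"
      using t0(1) unfolding T_def by blast
    obtain u' v' where "t0 = (u' + v') mod p" "[fst s = u'\<^sup>2] (mod p)" "[snd s = v'\<^sup>2] (mod p)"
      using t0(2) unfolding T_def by blast
    then have t: "(u + v) mod p \<in> T r"
      "[fst r = u\<^sup>2] (mod p)" "[snd r = v\<^sup>2] (mod p)"
      "[fst s = u'\<^sup>2] (mod p)" "[snd s = v'\<^sup>2] (mod p)" "(u + v) mod p = (u' + v') mod p"
      using t0 uv by simp_all
    have nz: "\<not> p dvd u + v"
      using t(1) T_card[OF rs(1)] by (auto simp: dvd_eq_mod_eq_0)
    \<comment> \<open>The sums agree, and in both representations sum times difference is congruent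
      to \<open>d\<close>. Cancelling the nonzero sum makes the differences agree too, and halving
      identifies the roots.\<close>
    have 1: "p dvd (u + v) - (u' + v')"
      using t(6) by (simp add: mod_eq_dvd_iff)
    have "[fst r - snd r = u\<^sup>2 - v\<^sup>2] (mod p)" "[fst s - snd s = u'\<^sup>2 - v'\<^sup>2] (mod p)"
      using t by (auto intro: cong_diff)
    moreover have "[fst r - snd r = d] (mod p)" "[fst s - snd s = d] (mod p)"
      using rs by (auto simp: sq_diff_def cong_iff_dvd_diff)
    ultimately have "[u\<^sup>2 - v\<^sup>2 = u'\<^sup>2 - v'\<^sup>2] (mod p)"
      by (metis cong_sym cong_trans)
    then have "p dvd (u\<^sup>2 - v\<^sup>2) - (u'\<^sup>2 - v'\<^sup>2) - ((u + v) - (u' + v')) * (u' - v')"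
      using 1 by (simp add: cong_iff_dvd_diff)
    then have "p dvd (u + v) * ((u - v) - (u' - v'))"
      by (simp add: power2_eq_square algebra_simps)
    then have 2: "p dvd (u - v) - (u' - v')"
      using nz by (simp add: dvd_mult_iff)
    have "p dvd 2 * (u - u')" "p dvd 2 * (v - v')"
      using dvd_add[OF 1 2] dvd_diff[OF 1 2] by (simp_all add: algebra_simps)
    then have "[u = u'] (mod p)" "[v = v'] (mod p)"
      using not_dvd_2 unfolding dvd_mult_iff cong_iff_dvd_diff by simp_all
    then have "[fst r = fst s] (mod p)" "[snd r = snd s] (mod p)"
      using t by (meson cong_pow cong_sym cong_trans)+
    then have "fst r = fst s" "snd r = snd s"
      using rs by (auto simp: sq_diff_def Q_def cong_def)
    then show False
      using rs(3) by (simp add: prod_eq_iff)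
  qed
  have fin: "finite (T r)" if "r \<in> sq_diff d" for r
    using T_card[OF that] finite_subset by blast
  \<comment> \<open>Disjoint sets of at least four elements each, inside the
    \<open>p - 1 = 2 * card Q\<close> nonzero residues.\<close>
  have "4 * card (sq_diff d) = (\<Sum>r\<in>sq_diff d. 4)"
    by simp
  also have "\<dots> \<le> (\<Sum>r\<in>sq_diff d. card (T r))"
    using T_card by (intro sum_mono) blast
  also have "\<dots> = card (\<Union>r\<in>sq_diff d. T r)"
    using T_disj fin by (subst card_UN_disjoint) auto
  also have "\<dots> \<le> card {1..<p}"
    using T_card by (intro card_mono) auto
  also have "\<dots> = 2 * card Q"
    by (subst p_eq) simp
  finally show ?thesis
    by simp
qed

subsection \<open>Images of square combinations\<close>

lemma not_dvd_mult_diff: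
  assumes "\<not> p dvd k" "a \<in> Q" "a' \<in> Q" "a \<noteq> a'"
  shows "\<not> p dvd k * (a - a')"
  using assms dvd_diff_eq[of a a'] by (auto simp: dvd_mult_iff Q_def)

text \<open>By \<open>coll\<close>, a collision is given by \<open>(a, a')\<close> and an element of
  \<open>sq_diff (k * (a - a'))\<close>. With \<open>q = card Q\<close>, there are at most
  \<open>q\<close> such elements if \<open>a = a'\<close> and at most \<open>q / 2\<close>
  otherwise, so twice the number of collisions is at most
  \<open>q\<^sup>2 * (q + 1)\<close>.\<close>

lemma card_image_pair:
  assumes k: "\<not> p dvd k"
    and coll: "\<And>a b a' b'. \<lbrakk>a \<in> Q; b \<in> Q; a' \<in> Q; b' \<in> Q; f (a, b) = f (a', b')\<rbrakk>
      \<Longrightarrow> p dvd b - b' - k * (a - a')"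
  shows "2 * (card Q)\<^sup>2 \<le> card (f ` (Q \<times> Q)) * (card Q + 1)"
proof -
  let ?q = "card Q"
  let ?C = "{(s, t). s \<in> Q \<times> Q \<and> t \<in> Q \<times> Q \<and> f s = f t}"
  let ?D = "SIGMA (a, a'):Q \<times> Q. sq_diff (k * (a - a'))"
  have bound: "2 * card (sq_diff (k * (a - a'))) \<le> ?q + (if a = a' then ?q else 0)"
    if "a \<in> Q" "a' \<in> Q" for a a'
    using card_sq_diff_le[of "k * (a - a')"]
      card_sq_diff[OF not_dvd_mult_diff[OF k that]] by auto
  have "card ?C \<le> card ?D"
  proof (rule card_inj_on_le[where f = "\<lambda>((a, b), (a', b')). ((a, a'), (b, b'))"])
    show "(\<lambda>((a, b), (a', b')). ((a, a'), (b, b'))) ` ?C \<subseteq> ?D"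
      using coll by (auto simp: sq_diff_def)
  qed (auto intro: inj_onI)
  also have "\<dots> = (\<Sum>a\<in>Q. \<Sum>a'\<in>Q. card (sq_diff (k * (a - a'))))"
    by (subst card_SigmaI) (auto simp: sum.cartesian_product case_prod_unfold)
  finally have "2 * card ?C \<le> (\<Sum>a\<in>Q. \<Sum>a'\<in>Q. 2 * card (sq_diff (k * (a - a'))))"
    by (simp flip: sum_distrib_left)
  also have "\<dots> \<le> (\<Sum>a\<in>Q. \<Sum>a'\<in>Q. ?q + (if a = a' then ?q else 0))"
    by (intro sum_mono bound)
  also have "\<dots> = ?q * (?q * ?q + ?q)"
    by (simp add: sum.distrib)
  finally have C: "2 * card ?C \<le> ?q\<^sup>2 * (?q + 1)"
    by (simp add: power2_eq_square algebra_simps)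
  have "(?q\<^sup>2)\<^sup>2 \<le> card (f ` (Q \<times> Q)) * card ?C"
    using card_power2_le_image_collisions[of "Q \<times> Q" f]
    by (simp add: card_cartesian_product power2_eq_square)
  then have "2 * (?q\<^sup>2)\<^sup>2 \<le> card (f ` (Q \<times> Q)) * (2 * card ?C)"
    by simp
  also have "\<dots> \<le> card (f ` (Q \<times> Q)) * (?q\<^sup>2 * (?q + 1))"
    using C by (rule mult_left_mono) simp
  finally have "?q\<^sup>2 * (2 * ?q\<^sup>2) \<le> ?q\<^sup>2 * (card (f ` (Q \<times> Q)) * (?q + 1))"
    by (simp add: power2_eq_square algebra_simps)
  then show ?thesis
    by (cases "?q = 0") (simp_all only: mult_le_cancel1, simp_all)
qed

text \<open>As for pairs, but \<open>a - a'\<close> now fixes two differences: each off-diagonal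
  \<open>(a, a')\<close> allows at most a quarter of \<open>q\<^sup>2\<close> collisions, where
  \<open>q = card Q\<close>, and each diagonal one at most \<open>q\<^sup>2\<close>.\<close>

lemma card_image_triple:
  assumes k: "\<not> p dvd k" and l: "\<not> p dvd l"
    and coll: "\<And>a b c a' b' c'. \<lbrakk>a \<in> Q; b \<in> Q; c \<in> Q; a' \<in> Q; b' \<in> Q; c' \<in> Q;
        f (a, b, c) = f (a', b', c')\<rbrakk>
      \<Longrightarrow> p dvd b - b' - k * (a - a') \<and> p dvd c - c' - l * (a - a')"
  shows "4 * (card Q)^3 \<le> card (f ` (Q \<times> Q \<times> Q)) * (card Q + 3)"
proof -
  let ?q = "card Q"
  let ?C = "{(s, t). s \<in> Q \<times> Q \<times> Q \<and> t \<in> Q \<times> Q \<times> Q \<and> f s = f t}"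
  let ?D = "SIGMA (a, a'):Q \<times> Q. sq_diff (k * (a - a')) \<times> sq_diff (l * (a - a'))"
  have bound: "4 * (card (sq_diff (k * (a - a'))) * card (sq_diff (l * (a - a'))))
      \<le> ?q\<^sup>2 + (if a = a' then 3 * ?q\<^sup>2 else 0)"
    if "a \<in> Q" "a' \<in> Q" for a a'
  proof (cases "a = a'")
    case True
    then show ?thesis
      using mult_mono[OF card_sq_diff_le card_sq_diff_le, of 0 0] by (simp add: power2_eq_square)
  next
    case False
    then show ?thesis
      using mult_mono[OF card_sq_diff[OF not_dvd_mult_diff[OF k that]]
          card_sq_diff[OF not_dvd_mult_diff[OF l that]]] by (simp add: power2_eq_square)
  qed
  have "card ?C \<le> card ?D"
  proof (rule card_inj_on_le[where f = "\<lambda>((a, b, c), (a', b', c')). ((a, a'), ((b, b'), (c, c')))"])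
    show "(\<lambda>((a, b, c), (a', b', c')). ((a, a'), ((b, b'), (c, c')))) ` ?C \<subseteq> ?D"
      using coll by (auto simp: sq_diff_def)
  qed (auto intro: inj_onI)
  also have "\<dots> = (\<Sum>a\<in>Q. \<Sum>a'\<in>Q. card (sq_diff (k * (a - a'))) * card (sq_diff (l * (a - a'))))"
    by (subst card_SigmaI) (auto simp: sum.cartesian_product card_cartesian_product case_prod_unfold)
  finally have "4 * card ?C \<le> (\<Sum>a\<in>Q. \<Sum>a'\<in>Q.
      4 * (card (sq_diff (k * (a - a'))) * card (sq_diff (l * (a - a')))))"
    by (simp flip: sum_distrib_left)
  also have "\<dots> \<le> (\<Sum>a\<in>Q. \<Sum>a'\<in>Q. ?q\<^sup>2 + (if a = a' then 3 * ?q\<^sup>2 else 0))"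
    by (intro sum_mono bound)
  also have "\<dots> = ?q * (?q * ?q\<^sup>2 + 3 * ?q\<^sup>2)"
    by (simp add: sum.distrib)
  finally have C: "4 * card ?C \<le> ?q^3 * (?q + 3)"
    by (simp add: power2_eq_square power3_eq_cube algebra_simps)
  have "(?q^3)\<^sup>2 \<le> card (f ` (Q \<times> Q \<times> Q)) * card ?C"
    using card_power2_le_image_collisions[of "Q \<times> Q \<times> Q" f]
    by (simp add: card_cartesian_product power3_eq_cube mult.assoc)
  then have "4 * (?q^3)\<^sup>2 \<le> card (f ` (Q \<times> Q \<times> Q)) * (4 * card ?C)"
    by simp
  also have "\<dots> \<le> card (f ` (Q \<times> Q \<times> Q)) * (?q^3 * (?q + 3))"
    using C by (rule mult_left_mono) simp
  finally have "?q^3 * (4 * ?q^3) \<le> ?q^3 * (card (f ` (Q \<times> Q \<times> Q)) * (?q + 3))"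
    by (simp add: power2_eq_square algebra_simps)
  then show ?thesis
    by (cases "?q = 0") (simp_all only: mult_le_cancel1, simp_all)
qed

text \<open>The factor is \<open>- x / y\<close> modulo \<open>p\<close>. It brings a collision of
  linear combinations into the form that the counting lemmas require.\<close>

lemma exists_ratio:
  assumes "\<not> p dvd x" "\<not> p dvd y"
  obtains k where "\<not> p dvd k" "\<And>d e. p dvd x * d + y * e \<Longrightarrow> p dvd e - k * d"
proof -
  obtain i where i: "p dvd y * i - 1" "\<not> p dvd i"
    using inverse_mod assms(2) by blast
  show ?thesis
  proof (rule that[of "- (x * i)"])
    show "\<not> p dvd - (x * i)"
      using assms(1) i(2) by (simp add: dvd_mult_iff)
    fix d e assume "p dvd x * d + y * e"
    then have "p dvd (x * d + y * e) * i - e * (y * i - 1)"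
      using i(1) by (intro dvd_diff[of p]) simp_all
    then show "p dvd e - - (x * i) * d"
      by (simp add: algebra_simps)
  qed
qed

text \<open>The values \<open>a * x + b * y\<close> fill at least \<open>card Q + 2\<close> residues
  and the values \<open>t - c * z\<close> fill \<open>card Q\<close>. Together these exceed
  \<open>p = 2 * card Q + 1\<close>, so the two sets meet.\<close>

lemma three_term_solvable:
  assumes q: "3 \<le> card Q" and nz: "\<not> p dvd x" "\<not> p dvd y" "\<not> p dvd z"
  shows "\<exists>a b c. sq a \<and> sq b \<and> sq c \<and> p dvd a * x + b * y + c * z - t"
proof -
  define f where "f = (\<lambda>(a, b). (a * x + b * y) mod p)"
  define g where "g c = (t - c * z) mod p" for c
  obtain k where k: "\<not> p dvd k" "\<And>d e. p dvd x * d + y * e \<Longrightarrow> p dvd e - k * d"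
    using exists_ratio nz by blast
  have "2 * (card Q)\<^sup>2 \<le> card (f ` (Q \<times> Q)) * (card Q + 1)"
  proof (rule card_image_pair[OF k(1)])
    fix a b a' b' assume "f (a, b) = f (a', b')"
    then have "p dvd x * (a - a') + y * (b - b')"
      by (simp add: f_def mod_eq_dvd_iff algebra_simps)
    then show "p dvd b - b' - k * (a - a')"
      by (rule k(2))
  qed
  then have f: "card Q + 2 \<le> card (f ` (Q \<times> Q))"
  proof (rule contrapos_pp)
    assume "\<not> card Q + 2 \<le> card (f ` (Q \<times> Q))"
    then have "card (f ` (Q \<times> Q)) * (card Q + 1) \<le> (card Q + 1) * (card Q + 1)"
      by (intro mult_right_mono) simp_all
    \<comment> \<open>At \<open>card Q = 3\<close> the inequality below reads 16 < 18; at 2 it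
      fails.\<close>
    moreover obtain j where "card Q = 3 + j"
      using q le_Suc_ex by blast
    then have "(card Q + 1) * (card Q + 1) < 2 * (card Q)\<^sup>2"
      by (simp add: power2_eq_square algebra_simps)
    ultimately show "\<not> 2 * (card Q)\<^sup>2 \<le> card (f ` (Q \<times> Q)) * (card Q + 1)"
      by linarith
  qed
  have "inj_on g Q"
  proof (rule inj_onI)
    fix c c' assume c: "c \<in> Q" "c' \<in> Q" "g c = g c'"
    then have "p dvd (c' - c) * z"
      by (simp add: g_def mod_eq_dvd_iff algebra_simps)
    then have "p dvd c' - c"
      using nz(3) by (simp add: dvd_mult_iff)
    then have "c' = c"
      by (rule dvd_diff_eq) (use c in \<open>simp_all add: Q_def\<close>)
    then show "c = c'" ..
  qed
  then have g: "card (g ` Q) = card Q"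
    by (rule card_image)
  have "f ` (Q \<times> Q) \<inter> g ` Q \<noteq> {}"
  proof
    assume "f ` (Q \<times> Q) \<inter> g ` Q = {}"
    then have "card (f ` (Q \<times> Q)) + card (g ` Q) = card (f ` (Q \<times> Q) \<union> g ` Q)"
      by (simp add: card_Un_disjoint)
    also have "\<dots> \<le> card {0..<p}"
      using gt_2 by (intro card_mono) (auto simp: f_def g_def)
    also have "\<dots> = 2 * card Q + 1"
      by (subst p_eq) simp
    finally show False
      using f g by simp
  qed
  then obtain a b c where "a \<in> Q" "b \<in> Q" "c \<in> Q" "f (a, b) = g c"
    by blast
  then show ?thesis
    by (intro exI[of _ a] exI[of _ b] exI[of _ c])
       (simp add: f_def g_def Q_def mod_eq_dvd_iff algebra_simps)
qed

text \<open>A collision satisfies two linear relations in three differences, so one difference fixes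
  the others and \<open>card_image_triple\<close> applies. The factor \<open>e\<close> will be 1 for
  one triple and \<open>- 1\<close> for the other.\<close>

lemma card_image_moments:
  assumes "5 \<le> card Q" "\<not> p dvd e"
    and xyz: "\<not> p dvd x - y" "\<not> p dvd x - z" "\<not> p dvd y - z"
  defines "f \<equiv> \<lambda>(a, b, c). (e * (a + b + c) mod p, e * (a * x + b * y + c * z) mod p)"
  shows "f ` (Q \<times> Q \<times> Q) \<subseteq> {0..<p} \<times> {0..<p}" "p\<^sup>2 < 2 * int (card (f ` (Q \<times> Q \<times> Q)))"
proof -
  show "f ` (Q \<times> Q \<times> Q) \<subseteq> {0..<p} \<times> {0..<p}"
    using gt_2 by (auto simp: f_def)
  obtain k where k: "\<not> p dvd k" "\<And>d e. p dvd (x - z) * d + (y - z) * e \<Longrightarrow> p dvd e - k * d"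
    using exists_ratio xyz by blast
  have "\<not> p dvd z - y"
    using xyz(3) by (simp add: dvd_diff_commute)
  then obtain l where l: "\<not> p dvd l" "\<And>d e. p dvd (x - y) * d + (z - y) * e \<Longrightarrow> p dvd e - l * d"
    using exists_ratio xyz by blast
  have "4 * (card Q)^3 \<le> card (f ` (Q \<times> Q \<times> Q)) * (card Q + 3)"
  proof (rule card_image_triple[OF k(1) l(1)])
    fix a b c a' b' c' assume "f (a, b, c) = f (a', b', c')"
    then have "p dvd e * ((a + b + c) - (a' + b' + c'))"
      "p dvd e * ((a * x + b * y + c * z) - (a' * x + b' * y + c' * z))"
      by (simp_all add: f_def mod_eq_dvd_iff right_diff_distrib)
    then have 1: "p dvd (a + b + c) - (a' + b' + c')"
      and 2: "p dvd (a * x + b * y + c * z) - (a' * x + b' * y + c' * z)"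
      using assms(2) by (simp_all add: dvd_mult_iff)
    \<comment> \<open>Subtracting \<open>z\<close> times relation 1 from relation 2 removes
      \<open>c - c'\<close>; subtracting \<open>y\<close> times it removes
      \<open>b - b'\<close>.\<close>
    have "p dvd (x - z) * (a - a') + (y - z) * (b - b')"
      using dvd_diff[OF 2 dvd_mult2[OF 1, of z]] by (simp add: algebra_simps)
    moreover have "p dvd (x - y) * (a - a') + (z - y) * (c - c')"
      using dvd_diff[OF 2 dvd_mult2[OF 1, of y]] by (simp add: algebra_simps)
    ultimately show "p dvd b - b' - k * (a - a') \<and> p dvd c - c' - l * (a - a')"
      using k(2) l(2) by blast
  qed
  then have "(2 * card Q + 1)\<^sup>2 < 2 * card (f ` (Q \<times> Q \<times> Q))"
  proof (rule contrapos_pp)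
    assume "\<not> (2 * card Q + 1)\<^sup>2 < 2 * card (f ` (Q \<times> Q \<times> Q))"
    then have "2 * card (f ` (Q \<times> Q \<times> Q)) * (card Q + 3) \<le> (2 * card Q + 1)\<^sup>2 * (card Q + 3)"
      by (intro mult_right_mono) simp_all
    \<comment> \<open>At \<open>card Q = 5\<close> the inequality below reads 968 < 1000; at 4 it
      fails.\<close>
    moreover obtain j where "card Q = 5 + j"
      using assms(1) le_Suc_ex by blast
    then have "(2 * card Q + 1)\<^sup>2 * (card Q + 3) < 2 * (4 * (card Q)^3)"
      by (simp add: power2_eq_square power3_eq_cube algebra_simps)
    ultimately show "\<not> 4 * (card Q)^3 \<le> card (f ` (Q \<times> Q \<times> Q)) * (card Q + 3)"
      by linarith
  qed
  then have "int ((2 * card Q + 1)\<^sup>2) < int (2 * card (f ` (Q \<times> Q \<times> Q)))"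
    by (simp only: of_nat_less_iff)
  then show "p\<^sup>2 < 2 * int (card (f ` (Q \<times> Q \<times> Q)))"
    by (subst p_eq) (simp add: add.commute[of 1])
qed

text \<open>The combinations of the vectors \<open>(1, x\<^sub>i)\<close> and the negated combinations of the vectors
  \<open>(1, y\<^sub>i)\<close> both fill more than half of the plane, so they meet.\<close>

lemma two_triples:
  assumes "5 \<le> card Q"
    and "\<not> p dvd x1 - x2" "\<not> p dvd x1 - x3" "\<not> p dvd x2 - x3"
    and "\<not> p dvd y1 - y2" "\<not> p dvd y1 - y3" "\<not> p dvd y2 - y3"
  shows "\<exists>a1 a2 a3 b1 b2 b3. sq a1 \<and> sq a2 \<and> sq a3 \<and> sq b1 \<and> sq b2 \<and> sq b3 \<and>
    p dvd a1 + a2 + a3 + b1 + b2 + b3 \<and>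
    p dvd a1 * x1 + a2 * x2 + a3 * x3 + b1 * y1 + b2 * y2 + b3 * y3"
proof -
  define f where "f = (\<lambda>(a, b, c). (1 * (a + b + c) mod p, 1 * (a * x1 + b * x2 + c * x3) mod p))"
  define g where "g = (\<lambda>(a, b, c). (- 1 * (a + b + c) mod p, - 1 * (a * y1 + b * y2 + c * y3) mod p))"
  let ?F = "f ` (Q \<times> Q \<times> Q)" and ?G = "g ` (Q \<times> Q \<times> Q)"
  have f: "?F \<subseteq> {0..<p} \<times> {0..<p}" "p\<^sup>2 < 2 * int (card ?F)"
    unfolding f_def using card_image_moments[OF assms(1) not_dvd_1 assms(2-4)] by blast+
  have m1: "\<not> p dvd - 1"
    using gt_2 by simp
  have g: "?G \<subseteq> {0..<p} \<times> {0..<p}" "p\<^sup>2 < 2 * int (card ?G)"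
    unfolding g_def using card_image_moments[OF assms(1) m1 assms(5-7)] by simp_all
  have "?F \<inter> ?G \<noteq> {}"
  proof
    assume "?F \<inter> ?G = {}"
    then have "card ?F + card ?G = card (?F \<union> ?G)"
      by (simp add: card_Un_disjoint)
    also have "\<dots> \<le> card ({0..<p} \<times> {0..<p})"
      using f(1) g(1) by (intro card_mono) auto
    finally have "int (card ?F) + int (card ?G) \<le> int (card ({0..<p} \<times> {0..<p}))"
      by linarith
    also have "\<dots> = p\<^sup>2"
      using gt_2 by (simp add: card_cartesian_product power2_eq_square)
    finally show False
      using f(2) g(2) by simp
  qed
  then obtain a1 a2 a3 b1 b2 b3 where *: "a1 \<in> Q" "a2 \<in> Q" "a3 \<in> Q" "b1 \<in> Q" "b2 \<in> Q" "b3 \<in> Q"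
    "f (a1, a2, a3) = g (b1, b2, b3)"
    by blast
  then have "p dvd (a1 + a2 + a3) - - (b1 + b2 + b3)"
    "p dvd (a1 * x1 + a2 * x2 + a3 * x3) - - (b1 * y1 + b2 * y2 + b3 * y3)"
    by (simp_all only: f_def g_def prod.case prod.inject mult_1 mult_minus1 mod_eq_dvd_iff)
  then have "p dvd a1 + a2 + a3 + b1 + b2 + b3"
    "p dvd a1 * x1 + a2 * x2 + a3 * x3 + b1 * y1 + b2 * y2 + b3 * y3"
    by (simp_all only: diff_minus_eq_add add.assoc)
  moreover have "sq a1" "sq a2" "sq a3" "sq b1" "sq b2" "sq b3"
    using * by (simp_all only: Q_def mem_Collect_eq)
  ultimately show ?thesis
    by blast
qed

subsection \<open>Square-weighted zero sums\<close>

text \<open>The two conditions are symmetric in the terms, so they depend only on the multiset of the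
  terms. With \<open>B = {b}\<close> the second one reads \<open>p dvd b * (a\<^sub>1 + \<dots> + a\<^sub>k)\<close>, and \<open>b\<close> can be cancelled.\<close>

definition square_zero_sum :: "int multiset \<Rightarrow> bool" where
  "square_zero_sum M \<longleftrightarrow> (\<exists>W. image_mset snd W = M \<and> (\<forall>w\<in>#W. sq (fst w)) \<and>
     p dvd (\<Sum>w\<in>#W. fst w) \<and> p dvd (\<Sum>w\<in>#W. fst w * snd w))"

lemma square_zero_sum_mset_weights:
  assumes "square_zero_sum (mset xs)"
  obtains as where "length as = length xs" "\<forall>a\<in>set as. sq a"
    "p dvd (\<Sum>i<length xs. as ! i)" "p dvd (\<Sum>i<length xs. as ! i * xs ! i)"
proof -
  obtain W where W: "image_mset snd W = mset xs" "\<forall>w\<in>#W. sq (fst w)"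
    "p dvd (\<Sum>w\<in>#W. fst w)" "p dvd (\<Sum>w\<in>#W. fst w * snd w)"
    using assms unfolding square_zero_sum_def by blast
  obtain ws where ws: "mset ws = W" "map snd ws = xs"
    using image_mset_eq_mset_map[OF W(1)] by blast
  have sum: "(\<Sum>w\<in>#W. h w) = (\<Sum>i<length xs. h (ws ! i))" for h :: "int \<times> int \<Rightarrow> int"
    unfolding ws(1)[symmetric] ws(2)[symmetric] 
    by (simp add: sum_mset_sum_list sum_list_sum_nth atLeast0LessThan flip: mset_map)
  show ?thesis
  proof (rule that[of "map fst ws"])
    show "\<forall>a\<in>set (map fst ws). sq a"
      using W(2) by (simp flip: ws(1))
    show "p dvd (\<Sum>i<length xs. map fst ws ! i)"
      using W(3) unfolding sum by (simp flip: ws(2))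
    show "p dvd (\<Sum>i<length xs. map fst ws ! i * xs ! i)"
      using W(4) unfolding sum by (simp flip: ws(2))
  qed (simp flip: ws(2))
qed

lemma square_zero_sum_weighted_list:
  assumes "\<forall>w\<in>set ws. sq (fst w)" "p dvd (\<Sum>w\<leftarrow>ws. fst w)" "p dvd (\<Sum>w\<leftarrow>ws. fst w * snd w)"
  shows "square_zero_sum (mset (map snd ws))"
proof -
  have "(\<Sum>w\<in>#mset ws. h w) = (\<Sum>w\<leftarrow>ws. h w)" for h :: "int \<times> int \<Rightarrow> int"
    by (metis mset_map sum_mset_sum_list)
  then show ?thesis
    unfolding square_zero_sum_def using assms by (intro exI[of _ "mset ws"]) simp
qed

section \<open>Zero sums from the multiplicities of the terms\<close>

lemma not_dvd_diff:
  assumes "a \<in> {0..<p}" "b \<in> {0..<p}" "a \<noteq> b"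
  shows "\<not> p dvd a - b"
  using assms dvd_diff_eq by blast

lemma size_ge_3_cases:
  assumes "3 \<le> size M"
  obtains x y z R where "M = {#x, y, z#} + R"
proof -
  obtain n where "size M = 3 + n"
    using assms le_Suc_ex by blast
  then have "size M = Suc (Suc (Suc n))"
    by simp
  then obtain x N where M: "M = add_mset x N" "size N = Suc (Suc n)"
    by (metis size_eq_Suc_imp_eq_union size_add_mset nat.inject)
  then obtain y K where N: "N = add_mset y K" "size K = Suc n"
    by (metis size_eq_Suc_imp_eq_union size_add_mset nat.inject)
  then obtain z R where "K = add_mset z R"
    by (metis size_eq_Suc_imp_eq_union)
  then show ?thesis
    using M N that[of x y z R] by simp
qed

lemma linear_equation_solvable:
  assumes "3 \<le> card Q" "3 \<le> size M" "\<forall>x\<in>#M. \<not> p dvd f x"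
  shows "\<exists>W. image_mset snd W = M \<and> (\<forall>w\<in>#W. sq (fst w)) \<and> p dvd (\<Sum>w\<in>#W. fst w * f (snd w)) - t"
proof -
  obtain x y z R where M: "M = {#x, y, z#} + R"
    using size_ge_3_cases assms(2) by blast
  have nz: "\<not> p dvd f x" "\<not> p dvd f y" "\<not> p dvd f z"
    using assms(3) by (simp_all add: M)
  obtain a b c where abc: "sq a" "sq b" "sq c"
    "p dvd a * f x + b * f y + c * f z - (t - (\<Sum>r\<in>#R. f r))"
    using three_term_solvable[OF assms(1) nz] by blast
  \<comment> \<open>Three terms absorb the sum of all others, which get weight 1.\<close>
  define W where "W = {#(a, x), (b, y), (c, z)#} + image_mset (\<lambda>r. (1, r)) R"
  have "(\<Sum>w\<in>#W. fst w * f (snd w)) = a * f x + b * f y + c * f z + (\<Sum>r\<in>#R. f r)"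
    by (simp add: W_def image_mset.compositionality o_def)
  then have "p dvd (\<Sum>w\<in>#W. fst w * f (snd w)) - t"
    using abc(4) by (simp add: algebra_simps)
  moreover have "image_mset snd W = M" "\<forall>w\<in>#W. sq (fst w)"
    using abc by (auto simp: W_def M image_mset.compositionality o_def)
  ultimately show ?thesis
    by blast
qed

text \<open>The terms are shifted by \<open>u\<close>. Those different from \<open>u\<close> are
  weighted so that the shifted sum vanishes; the copies of \<open>u\<close> do not affect it and are
  then weighted to make the total weight vanish.\<close>

lemma square_zero_sum_of_triple_multiplicity:
  assumes q: "3 \<le> card Q" and M: "set_mset M \<subseteq> {0..<p}"
    and u: "3 \<le> count M u" and others: "3 \<le> size {#x \<in># M. x \<noteq> u#}"
  shows "square_zero_sum M"
proof -
  have "u \<in># M"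
    using u by (simp flip: count_greater_zero_iff)
  then have "\<forall>x\<in>#{#x \<in># M. x \<noteq> u#}. \<not> p dvd x - u"
    using M by (metis (mono_tags, lifting) not_dvd_diff mem_Collect_eq set_mset_filter subsetD)
  then obtain W1 where W1: "image_mset snd W1 = {#x \<in># M. x \<noteq> u#}" "\<forall>w\<in>#W1. sq (fst w)"
    "p dvd (\<Sum>w\<in>#W1. fst w * (snd w - u))"
    using linear_equation_solvable[OF q others, of "\<lambda>x. x - u" 0] by auto
  \<comment> \<open>With the constant coefficient 1, the linear equation prescribes the total weight
    on the copies of \<open>u\<close>.\<close>
  obtain W2 where W2: "image_mset snd W2 = replicate_mset (count M u) u" "\<forall>w\<in>#W2. sq (fst w)"
    "p dvd (\<Sum>w\<in>#W2. fst w * 1) - - (\<Sum>w\<in>#W1. fst w)"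
    using linear_equation_solvable[OF q, of "replicate_mset (count M u) u" "\<lambda>_. 1"] u not_dvd_1
    by (metis size_replicate_mset)
  have "\<forall>w\<in>#W2. snd w = u"
    using arg_cong[OF W2(1), of set_mset] by (auto split: if_splits)
  then have "(\<Sum>w\<in>#W2. fst w * snd w) = (\<Sum>w\<in>#W2. fst w * u)"
    by (intro arg_cong[where f = sum_mset] image_mset_cong) simp
  also have "\<dots> = u * (\<Sum>w\<in>#W2. fst w)"
    by (simp add: sum_mset_distrib_left mult.commute)
  finally have sum2: "(\<Sum>w\<in>#W2. fst w * snd w) = u * (\<Sum>w\<in>#W2. fst w)" .
  have sum1: "(\<Sum>w\<in>#W1. fst w * snd w) = (\<Sum>w\<in>#W1. fst w * (snd w - u)) + u * (\<Sum>w\<in>#W1. fst w)"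
    by (simp add: sum_mset_distrib_left algebra_simps flip: sum_mset.distrib)
  have tot: "p dvd (\<Sum>w\<in>#W1. fst w) + (\<Sum>w\<in>#W2. fst w)"
    using W2(3) by (simp add: add.commute)
  have "p dvd (\<Sum>w\<in>#W1. fst w * (snd w - u)) + u * ((\<Sum>w\<in>#W1. fst w) + (\<Sum>w\<in>#W2. fst w))"
    by (rule dvd_add[OF W1(3) dvd_mult[OF tot]])
  then have "p dvd (\<Sum>w\<in>#W1. fst w * snd w) + (\<Sum>w\<in>#W2. fst w * snd w)"
    by (simp add: sum1 sum2 algebra_simps)
  moreover have "{#x \<in># M. x \<noteq> u#} + replicate_mset (count M u) u = M"
    by (rule multiset_eqI) auto
  ultimately show ?thesis
    unfolding square_zero_sum_def using W1 W2 tot by (intro exI[of _ "W1 + W2"]) auto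
qed

text \<open>In sorted order, entries two places apart differ, since equality would give three equal
  terms. Hence the odd places and the even places each form a triple of distinct values, to which
  \<open>two_triples\<close> applies.\<close>

lemma square_zero_sum_of_small_multiplicities:
  assumes q: "5 \<le> card Q" and xs: "length xs = 6" "set xs \<subseteq> {0..<p}"
    and mult: "\<And>u. count (mset xs) u \<le> 2"
  shows "square_zero_sum (mset xs)"
proof -
  define ys where "ys = sort xs"
  have "length ys = 6"
    using xs(1) by (simp add: ys_def)
  then obtain y1 y2 y3 y4 y5 y6 where "ys = [y1, y2, y3, y4, y5, y6]"
    by (auto simp: numeral_eq_Suc length_Suc_conv)
  then have sort: "sort xs = [y1, y2, y3, y4, y5, y6]"
    by (simp only: ys_def)
  have M: "mset xs = {#y1, y2, y3, y4, y5, y6#}"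
    using mset_sort[of "\<lambda>x. x" xs] unfolding sort by simp
  have sorted: "y1 \<le> y2" "y2 \<le> y3" "y3 \<le> y4" "y4 \<le> y5" "y5 \<le> y6"
    using sorted_sort[of xs] unfolding sort by simp_all
  have mult': "False" if "mset xs = {#a, b, c#} + N" "a \<le> b" "b \<le> c" "a = c" for a b c N
    using mult[of a] that by simp
  have "y1 \<noteq> y3"
    using mult'[of y1 y2 y3 "{#y4, y5, y6#}"] sorted by (auto simp: M)
  moreover have "y2 \<noteq> y4"
    using mult'[of y2 y3 y4 "{#y1, y5, y6#}"] sorted by (auto simp: M add_mset_commute)
  moreover have "y3 \<noteq> y5"
    using mult'[of y3 y4 y5 "{#y1, y2, y6#}"] sorted by (auto simp: M add_mset_commute)
  moreover have "y4 \<noteq> y6"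
    using mult'[of y4 y5 y6 "{#y1, y2, y3#}"] sorted by (auto simp: M add_mset_commute)
  ultimately have less: "y1 < y3" "y3 < y5" "y2 < y4" "y4 < y6"
    using sorted by linarith+
  have "set_mset (mset xs) \<subseteq> {0..<p}"
    using xs(2) by simp
  then have "y1 \<in> {0..<p}" "y2 \<in> {0..<p}" "y3 \<in> {0..<p}"
    "y4 \<in> {0..<p}" "y5 \<in> {0..<p}" "y6 \<in> {0..<p}"
    unfolding M by simp_all
  then have nd: "\<not> p dvd y1 - y3" "\<not> p dvd y1 - y5" "\<not> p dvd y3 - y5"
    "\<not> p dvd y2 - y4" "\<not> p dvd y2 - y6" "\<not> p dvd y4 - y6"
    using less by (intro not_dvd_diff; simp)+
  obtain a1 a2 a3 b1 b2 b3 where *: "sq a1" "sq a2" "sq a3" "sq b1" "sq b2" "sq b3"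
    "p dvd a1 + a2 + a3 + b1 + b2 + b3"
    "p dvd a1 * y1 + a2 * y3 + a3 * y5 + b1 * y2 + b2 * y4 + b3 * y6"
    using two_triples[OF q nd] by blast
  have "square_zero_sum (mset (map snd [(a1, y1), (a2, y3), (a3, y5), (b1, y2), (b2, y4), (b3, y6)]))"
    by (rule square_zero_sum_weighted_list) (use * in \<open>simp_all add: add.assoc\<close>)
  moreover have "mset (map snd [(a1, y1), (a2, y3), (a3, y5), (b1, y2), (b2, y4), (b3, y6)]) = mset xs"
    unfolding M by (simp add: add_mset_commute)
  ultimately show ?thesis
    by simp
qed

lemma square_zero_sum_pair:
  assumes "sq (- 1)"
  shows "square_zero_sum (mset [x, x])"
  using square_zero_sum_weighted_list[of "[(1, x), (- 1, x)]"] assms by simp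

text \<open>Each of the three unequal pairs contains a term different from \<open>u\<close>, which
  supplies the three other terms needed when \<open>u\<close> occurs three times.\<close>

lemma square_zero_sum_length_6:
  assumes q: "5 \<le> card Q" and xs: "set [x1, x2, x3, x4, x5, x6] \<subseteq> {0..<p}"
    and neq: "x1 \<noteq> x2" "x3 \<noteq> x4" "x5 \<noteq> x6"
  shows "square_zero_sum (mset [x1, x2, x3, x4, x5, x6])"
proof (cases "\<exists>u. 3 \<le> count (mset [x1, x2, x3, x4, x5, x6]) u")
  case True
  then obtain u where u: "3 \<le> count (mset [x1, x2, x3, x4, x5, x6]) u"
    by blast
  have pair: "1 \<le> length (filter (\<lambda>x. x \<noteq> u) [x, y])" if "x \<noteq> y" for x y
    using that by simp
  have "3 \<le> length (filter (\<lambda>x. x \<noteq> u) ([x1, x2] @ [x3, x4] @ [x5, x6]))"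
    using pair[OF neq(1)] pair[OF neq(2)] pair[OF neq(3)]
    unfolding filter_append length_append by linarith
  then have others: "3 \<le> size {#x \<in># mset [x1, x2, x3, x4, x5, x6]. x \<noteq> u#}"
    unfolding mset_filter[symmetric] size_mset append.simps .
  have "3 \<le> card Q"
    using q by simp
  then show ?thesis
    by (rule square_zero_sum_of_triple_multiplicity[OF _ _ u others]) (use xs in \<open>simp only: set_mset_mset\<close>)
next
  case False
  have "count (mset [x1, x2, x3, x4, x5, x6]) u \<le> 2" for u
  proof -
    have "\<not> 3 \<le> count (mset [x1, x2, x3, x4, x5, x6]) u"
      using False by blast
    then show ?thesis
      by linarith
  qed
  moreover have "length [x1, x2, x3, x4, x5, x6] = 6"
    by simp
  ultimately show ?thesis
    using square_zero_sum_of_small_multiplicities[OF q _ xs] by blast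
qed

text \<open>Each of the three non-constant triples contains a term different from \<open>u\<close>.
  This covers \<open>p = 7\<close> as well.\<close>

lemma square_zero_sum_length_9:
  assumes q: "3 \<le> card Q" and xs: "set [x1, x2, x3, x4, x5, x6, x7, x8, x9] \<subseteq> {0..<p}"
    and u: "3 \<le> count (mset [x1, x2, x3, x4, x5, x6, x7, x8, x9]) u"
    and neq: "\<not> (x1 = x2 \<and> x2 = x3)" "\<not> (x4 = x5 \<and> x5 = x6)" "\<not> (x7 = x8 \<and> x8 = x9)"
  shows "square_zero_sum (mset [x1, x2, x3, x4, x5, x6, x7, x8, x9])"
proof -
  have triple: "1 \<le> length (filter (\<lambda>x. x \<noteq> u) [x, y, z])" if "\<not> (x = y \<and> y = z)" for x y z
    using that by auto
  have "3 \<le> length (filter (\<lambda>x. x \<noteq> u) ([x1, x2, x3] @ [x4, x5, x6] @ [x7, x8, x9]))"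
    using triple[OF neq(1)] triple[OF neq(2)] triple[OF neq(3)]
    unfolding filter_append length_append by linarith
  then have others: "3 \<le> size {#x \<in># mset [x1, x2, x3, x4, x5, x6, x7, x8, x9]. x \<noteq> u#}"
    unfolding mset_filter[symmetric] size_mset append.simps .
  show ?thesis
    by (rule square_zero_sum_of_triple_multiplicity[OF q _ u others]) (use xs in \<open>simp only: set_mset_mset\<close>)
qed

lemma square_zero_sum_triple:
  assumes "3 \<le> card Q"
  shows "square_zero_sum (mset [x, x, x])"
proof -
  obtain a b c where abc: "sq a" "sq b" "sq c" "p dvd a * 1 + b * 1 + c * 1 - 0"
    using three_term_solvable[OF assms not_dvd_1 not_dvd_1 not_dvd_1] by blast
  then have "p dvd x * (a + b + c)"
    by simp
  then show ?thesis
    using square_zero_sum_weighted_list[of "[(a, x), (b, x), (c, x)]"] abc by (simp add: algebra_simps)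
qed

subsection \<open>Small primes and blocks\<close>

lemma card_linear_roots_le:
  assumes "\<not> p dvd g"
  shows "card {a \<in> Q. p dvd a * g + h} \<le> 1"
proof -
  have "a = b" if "a \<in> Q" "p dvd a * g + h" "b \<in> Q" "p dvd b * g + h" for a b
  proof (rule dvd_diff_eq)
    have "p dvd (a - b) * g"
      using dvd_diff[OF that(2,4)] by (simp add: algebra_simps)
    then show "p dvd a - b"
      using assms by (simp add: dvd_mult_iff)
  qed (use that in \<open>simp_all add: Q_def\<close>)
  then have "\<forall>a\<in>{a \<in> Q. p dvd a * g + h}. \<forall>b\<in>{a \<in> Q. p dvd a * g + h}. a = b"
    by blast
  then show ?thesis
    by (simp add: card_le_Suc0_iff_eq)
qed

text \<open>Two equal terms contribute any prescribed nonzero multiple of their value. Two such pairs absorb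
  the rest of the sum as long as the two coefficients that this forces are nonzero, and varying the
  weight of one further term achieves that.\<close>

lemma square_zero_sum_of_two_doubles:
  assumes q: "3 \<le> card Q"
    and two_squares: "\<And>d. \<not> p dvd d \<Longrightarrow> \<exists>a b. sq a \<and> sq b \<and> p dvd a + b - d"
    and nd: "\<not> p dvd u - w" "\<not> p dvd z - u" "\<not> p dvd z - w"
  shows "square_zero_sum ({#u, u, w, w, z#} + R)"
proof -
  define s t where "s = int (size R)" and "t = \<Sum>\<^sub># R"
  \<comment> \<open>\<open>?A w\<close> holds the weights \<open>a\<close> of \<open>z\<close> for
    which the total weight forced on the copies of \<open>u\<close> vanishes modulo
    \<open>p\<close>, and \<open>?A u\<close> those for the copies of \<open>w\<close>. Each
    excludes at most one of at least three squares.\<close>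
  let ?A = "\<lambda>v. {a \<in> Q. p dvd a * (z - v) + (t - v * s)}"
  have "card (?A w \<union> ?A u) \<le> 2"
    using card_Un_le[of "?A w" "?A u"] card_linear_roots_le[OF nd(3), of "t - w * s"]
      card_linear_roots_le[OF nd(2), of "t - u * s"] by linarith
  then have "\<not> Q \<subseteq> ?A w \<union> ?A u"
    using q card_mono[of "?A w \<union> ?A u" Q] by auto
  then obtain a where a: "a \<in> Q" "\<not> p dvd a * (z - w) + (t - w * s)" "\<not> p dvd a * (z - u) + (t - u * s)"
    by blast
  define X where "X = a * (z - w) + (t - w * s)"
  obtain i where i: "p dvd (u - w) * i - 1" "\<not> p dvd i"
    using inverse_mod nd(1) by blast
  \<comment> \<open>The solution of \<open>d + e = - (a + s)\<close> and
    \<open>d * u + e * w = - (a * z + t)\<close> modulo \<open>p\<close>, where \<open>i\<close>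
    inverts \<open>u - w\<close> and the terms of \<open>R\<close> have weight 1.\<close>
  define d e where "d = - (X * i)" and "e = - (a + s) - d"
  have "\<not> p dvd d"
    using a(2) i(2) by (simp add: d_def X_def dvd_mult_iff)
  then obtain a1 a2 where a12: "sq a1" "sq a2" "p dvd a1 + a2 - d"
    using two_squares by blast
  have "\<not> p dvd e"
  proof
    assume "p dvd e"
    then have "p dvd (u - w) * e - X * ((u - w) * i - 1)"
      by (rule dvd_diff[OF dvd_mult dvd_mult[OF i(1)]])
    also have "(u - w) * e - X * ((u - w) * i - 1) = a * (z - u) + (t - u * s)"
      by (simp add: e_def d_def X_def algebra_simps)
    finally show False
      using a(3) by simp
  qed
  then obtain b1 b2 where b12: "sq b1" "sq b2" "p dvd b1 + b2 - e"
    using two_squares by blast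
  define W where "W = {#(a1, u), (a2, u), (b1, w), (b2, w), (a, z)#} + image_mset (\<lambda>r. (1, r)) R"
  have "(\<Sum>w\<in>#W. fst w) = (a1 + a2 - d) + (b1 + b2 - e)"
    by (simp add: W_def s_def e_def image_mset.compositionality o_def)
  then have 1: "p dvd (\<Sum>w\<in>#W. fst w)"
    using a12(3) b12(3) by simp
  have "(\<Sum>w\<in>#W. fst w * snd w) = (a1 + a2) * u + (b1 + b2) * w + a * z + t"
    by (simp add: W_def t_def image_mset.compositionality o_def distrib_right)
  also have "\<dots> = (a1 + a2 - d) * u + (b1 + b2 - e) * w - X * ((u - w) * i - 1)"
    by (simp add: X_def d_def e_def algebra_simps)
  finally have 2: "p dvd (\<Sum>w\<in>#W. fst w * snd w)"
    using a12(3) b12(3) i(1) by (metis dvd_add dvd_diff dvd_mult dvd_mult2)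
  have "image_mset snd W = {#u, u, w, w, z#} + R" "\<forall>w\<in>#W. sq (fst w)"
    using a a12 b12 by (auto simp: W_def Q_def image_mset.compositionality o_def)
  then show ?thesis
    unfolding square_zero_sum_def using 1 2 by blast
qed

text \<open>Nine terms with only seven values, each used at most twice, contain two doubled values
  \<open>u\<close> and \<open>w\<close>; any of the other five terms can serve as \<open>z\<close>.
  Every nonzero residue modulo 7 is a sum of two of the squares 1, 2, 4.\<close>

lemma square_zero_sum_mod_7:
  assumes p: "p = 7" and M: "size M = 9" "set_mset M \<subseteq> {0..<p}" and mult: "\<And>u. count M u \<le> 2"
  shows "square_zero_sum M"
proof -
  define D where "D = {u \<in> {0..<p}. count M u = 2}"
  have "finite D"
    by (rule finite_subset[of _ "{0..<p}"]) (auto simp: D_def)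
  have "9 = (\<Sum>u\<in>set_mset M. count M u)"
    using M(1) by (simp add: size_multiset_overloaded_eq)
  also have "\<dots> = (\<Sum>u\<in>{0..<p}. count M u)"
    using M(2) by (intro sum.mono_neutral_left) (auto simp: not_in_iff)
  also have "\<dots> \<le> (\<Sum>u\<in>{0..<p}. 1 + (if u \<in> D then 1 else 0))"
  proof (rule sum_mono)
    fix u assume "u \<in> {0..<p}"
    then show "count M u \<le> 1 + (if u \<in> D then 1 else 0)"
      using mult[of u] by (auto simp: D_def)
  qed
  also have "\<dots> = (\<Sum>u\<in>{0..<p}. 1) + (\<Sum>u\<in>{0..<p}. if u \<in> D then 1 else 0)"
    by (rule sum.distrib)
  also have "(\<Sum>u\<in>{0..<p}. if u \<in> D then 1 else 0) = card D"
    by (simp add: D_def flip: sum.inter_filter)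
  finally have "\<not> card D \<le> Suc 0"
    using p by simp
  then obtain u w where uw: "u \<in> D" "w \<in> D" "u \<noteq> w"
    using \<open>finite D\<close> by (auto simp: card_le_Suc0_iff_eq)
  define N where "N = M - {#u, u, w, w#}"
  have "{#u, u, w, w#} \<subseteq># M"
    using uw by (auto simp: subseteq_mset_def D_def)
  then have "{#u, u, w, w#} + N = M"
    unfolding N_def by (rule subset_mset.add_diff_inverse)
  then have MN: "M = {#u, u, w, w#} + N" ..
  then have "size N = 5"
    using M(1) by simp
  then obtain z R where N: "N = add_mset z R"
    by (metis size_eq_Suc_imp_eq_union eval_nat_numeral(3))
  have "count N u = 0" "count N w = 0"
    using uw unfolding N_def by (simp_all add: D_def)
  then have "z \<noteq> u" "z \<noteq> w"
    unfolding N by (auto split: if_splits)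
  moreover have "u \<in> {0..<p}" "w \<in> {0..<p}" "z \<in> {0..<p}"
    using uw M(2) unfolding MN N D_def by auto
  ultimately have nd: "\<not> p dvd u - w" "\<not> p dvd z - u" "\<not> p dvd z - w"
    using uw(3) by (intro not_dvd_diff; simp)+
  have "sq 2"
    unfolding sq_def by (rule exI[of _ 3]) (simp add: cong_def p)
  moreover from this have "sq (2 * 2)"
    using sq_mult by blast
  ultimately have sq: "sq 1" "sq 2" "sq 4"
    by simp_all
  have two_squares: "\<exists>a b. sq a \<and> sq b \<and> p dvd a + b - d" if "\<not> p dvd d" for d
  proof -
    have "p dvd 1 + 1 - d \<or> p dvd 1 + 2 - d \<or> p dvd 2 + 2 - d \<or> p dvd 1 + 4 - d \<or>
        p dvd 2 + 4 - d \<or> p dvd 4 + 4 - d"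
      using that unfolding p by presburger
    then show ?thesis
      using sq by blast
  qed
  have "3 \<le> card Q"
    using p_eq p by simp
  then have "square_zero_sum ({#u, u, w, w, z#} + R)"
    using two_squares nd by (rule square_zero_sum_of_two_doubles)
  moreover have "M = {#u, u, w, w, z#} + R"
    by (simp add: MN N add_mset_commute)
  ultimately show ?thesis
    by (simp only:)
qed

lemma square_zero_sum_signs:
  assumes "sq (- 1)" "set ss \<subseteq> {1, - 1}" "length ss = length xs"
    and "p dvd sum_list ss" "p dvd (\<Sum>(s, x)\<leftarrow>zip ss xs. s * x)"
  shows "square_zero_sum (mset xs)"
proof -
  have fst_snd: "map fst (zip ss xs) = ss" "map snd (zip ss xs) = xs"
    using assms(3) by simp_all
  have "sq s" if "s \<in> set ss" for s
    using that assms(1,2) sq_1 by blast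
  moreover have "fst ` set (zip ss xs) = set ss"
    using fst_snd(1) by (metis set_map)
  ultimately have "\<forall>w\<in>set (zip ss xs). sq (fst w)"
    by blast
  then have "square_zero_sum (mset (map snd (zip ss xs)))"
    by (rule square_zero_sum_weighted_list) (use assms(4,5) fst_snd in \<open>simp_all only: case_prod_unfold\<close>)
  then show ?thesis
    by (simp only: fst_snd)
qed

text \<open>Opposite signs inside each pair reduce the task to the differences \<open>a\<close>,
  \<open>b\<close>, \<open>c\<close>. Up to sign, nonzero ones are 1 or 2; if no neighbours agree up
  to sign, the pattern is 1, 2, 1 or 2, 1, 2, and \<open>1 - 2 + 1\<close> or
  \<open>2 + 1 + 2\<close> is divisible by 5.\<close>

lemma block_mod_5:
  assumes p: "p = 5"
  shows "\<exists>ys. ys \<noteq> [] \<and> sublist ys [x1, x2, x3, x4, x5, x6] \<and> square_zero_sum (mset ys)"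
proof -
  have sq: "sq (- 1)"
    unfolding sq_def by (rule exI[of _ 2]) (simp add: cong_def p)
  define a b c where "a = x1 - x2" and "b = x3 - x4" and "c = x5 - x6"
  have two: "square_zero_sum (mset [y1, y2])" if "p dvd y1 - y2" for y1 y2
    using that by (intro square_zero_sum_signs[OF sq, of "[1, - 1]"]) auto
  have four: "square_zero_sum (mset [y1, y2, y3, y4])"
    if "p dvd (y1 - y2) + s * (y3 - y4)" "s \<in> {1, - 1}" for y1 y2 y3 y4 s
    using that by (intro square_zero_sum_signs[OF sq, of "[1, - 1, s, - s]"]) (auto simp: algebra_simps)
  have six: "square_zero_sum (mset [x1, x2, x3, x4, x5, x6])"
    if "p dvd a + s * b + t * c" "s \<in> {1, - 1}" "t \<in> {1, - 1}" for s t
    using that by (intro square_zero_sum_signs[OF sq, of "[1, - 1, s, - s, t, - t]"])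
      (auto simp: algebra_simps a_def b_def c_def)
  have "5 dvd a \<or> 5 dvd b \<or> 5 dvd c \<or> 5 dvd a + 1 * b \<or> 5 dvd a + - 1 * b \<or>
      5 dvd b + 1 * c \<or> 5 dvd b + - 1 * c \<or>
      5 dvd a + 1 * b + 1 * c \<or> 5 dvd a + 1 * b + - 1 * c \<or>
      5 dvd a + - 1 * b + 1 * c \<or> 5 dvd a + - 1 * b + - 1 * c"
    by presburger
  then consider "p dvd a" | "p dvd b" | "p dvd c" | s where "p dvd a + s * b" "s \<in> {1, - 1}"
    | s where "p dvd b + s * c" "s \<in> {1, - 1}"
    | s t where "p dvd a + s * b + t * c" "s \<in> {1, - 1}" "t \<in> {1, - 1}"
    unfolding p by blast
  then have "\<exists>ys\<in>{[x1, x2], [x3, x4], [x5, x6], [x1, x2, x3, x4], [x3, x4, x5, x6],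
      [x1, x2, x3, x4, x5, x6]}. square_zero_sum (mset ys)"
  proof cases
    case 1
    then show ?thesis
      using two a_def by blast
  next
    case 2
    then show ?thesis
      using two b_def by blast
  next
    case 3
    then show ?thesis
      using two c_def by blast
  next
    case 4
    then show ?thesis
      using four a_def b_def by blast
  next
    case 5
    then show ?thesis
      using four b_def c_def by blast
  next
    case 6
    then show ?thesis
      using six by blast
  qed
  then obtain ys where "square_zero_sum (mset ys)" and
    ys: "ys \<in> {[x1, x2], [x3, x4], [x5, x6], [x1, x2, x3, x4], [x3, x4, x5, x6],
      [x1, x2, x3, x4, x5, x6]}"
    by blast
  moreover have "ys \<noteq> [] \<and> sublist ys [x1, x2, x3, x4, x5, x6]"
    using ys by (elim insertE emptyE) (simp_all add: sublist_code)
  ultimately show ?thesis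
    by blast
qed

text \<open>With all weights 1, a block needs length and sum divisible by 3. The ten prefixes have
  only nine pairs of length and sum modulo 3, so two prefixes agree and their difference is such a
  block.\<close>

lemma block_mod_3:
  assumes p: "p = 3" and xs: "length xs = 9"
  shows "\<exists>ys. ys \<noteq> [] \<and> sublist ys xs \<and> square_zero_sum (mset ys)"
proof -
  define f where "f i = (int i mod 3, sum_list (take i xs) mod 3)" for i
  have "f ` {..9} \<subseteq> {0..<3} \<times> {0..<3}"
    by (auto simp: f_def)
  then have "card (f ` {..9}) \<le> card ({0..<3::int} \<times> {0..<3::int})"
    by (intro card_mono) auto
  then have "card (f ` {..9}) < card {..9::nat}"
    by simp
  then have "\<not> inj_on f {..9}"
    by (rule pigeonhole)
  then obtain i j where ij: "i < j" "j \<le> 9" "f i = f j"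
    by (metis atMost_iff inj_on_def linorder_neqE_nat)
  define ys where "ys = take (j - i) (drop i xs)"
  have len: "length ys = j - i"
    using ij xs by (simp add: ys_def)
  have "take j xs = take i xs @ ys"
    using ij(1) take_add[of i "j - i" xs] by (simp add: ys_def)
  then have "sum_list ys = sum_list (take j xs) - sum_list (take i xs)"
    by simp
  then have "3 dvd sum_list ys"
    using ij(3) by (simp add: f_def mod_eq_dvd_iff[symmetric])
  moreover have "3 dvd int (length ys)"
    using ij unfolding len by (simp add: f_def of_nat_diff mod_eq_dvd_iff[symmetric])
  moreover have "(\<Sum>w\<leftarrow>map (Pair (1::int)) ys. fst w) = int (length ys)"
    "(\<Sum>w\<leftarrow>map (Pair (1::int)) ys. fst w * snd w) = sum_list ys"
    by (simp_all add: o_def sum_list_triv)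
  ultimately have "square_zero_sum (mset (map snd (map (Pair (1::int)) ys)))"
    unfolding p[symmetric] by (intro square_zero_sum_weighted_list) auto
  then have "square_zero_sum (mset ys)"
    by (simp add: o_def)
  moreover have "ys \<noteq> []"
    using len ij(1) by auto
  moreover have "sublist ys xs"
    unfolding ys_def by (meson sublist_drop sublist_order.order.trans sublist_take)
  ultimately show ?thesis
    by blast
qed

text \<open>Euler's criterion with exponent \<open>(p - 1) / 2 = card Q\<close>: the answer depends
  on the parity of \<open>card Q\<close>.\<close>

lemma sq_minus_1_iff: "sq (- 1) \<longleftrightarrow> p mod 4 = 1"
proof -
  define n where "n = nat p"
  have n1: "p = int n"
    using gt_2 by (simp add: n_def)
  have "prime (int n)" "2 < int n"
    using prime gt_2 by (simp_all only: n1[symmetric])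
  then have n: "p = int n" "prime n" "2 < n"
    using n1 by simp_all
  have "n = 2 * card Q + 1"
    using p_eq n(1) by linarith
  then have q: "(n - 1) div 2 = card Q"
    by simp
  have nz: "\<not> [- 1 = 0] (mod p)" "\<not> [- 1 = 1] (mod p)" "\<not> [1 = - 1] (mod p)"
    unfolding cong_iff_dvd_diff using gt_2 not_dvd_2 by simp_all
  have QR: "sq (- 1) \<longleftrightarrow> QuadRes p (- 1)"
  proof
    assume "QuadRes p (- 1)"
    then obtain y where y: "[y\<^sup>2 = - 1] (mod p)"
      by (auto simp: QuadRes_def)
    have "\<not> p dvd y"
    proof
      assume "p dvd y"
      then have "p dvd y\<^sup>2"
        by (simp add: power2_eq_square)
      then have "p dvd - 1"
        using cong_dvd_iff[OF y] by blast
      then show False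
        using gt_2 by simp
    qed
    then show "sq (- 1)"
      unfolding sq_def using cong_sym[OF y] by blast
  next
    assume "sq (- 1)"
    then obtain y where "[- 1 = y\<^sup>2] (mod p)"
      by (auto simp: sq_def)
    then have "[y\<^sup>2 = - 1] (mod p)"
      by (rule cong_sym)
    then show "QuadRes p (- 1)"
      unfolding QuadRes_def by blast
  qed
  have L: "[Legendre (- 1) p = (- 1) ^ card Q] (mod p)"
    using euler_criterion[OF n(2,3), of "- 1"] unfolding q n(1)[symmetric] .
  have Leg: "Legendre (- 1) p = (if QuadRes p (- 1) then 1 else - 1)"
    unfolding Legendre_def using nz(1) by (simp only: if_False)
  have "QuadRes p (- 1) \<longleftrightarrow> even (card Q)"
  proof (cases "even (card Q)")
    case True
    then have "[Legendre (- 1) p = 1] (mod p)"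
      using L True by simp
    then have "QuadRes p (- 1)"
      using nz(2) unfolding Leg by presburger
    with True show ?thesis
      by simp
  next
    case False
    then have "[Legendre (- 1) p = - 1] (mod p)"
      using L False by simp
    then have "\<not> QuadRes p (- 1)"
      using nz(3) unfolding Leg by presburger
    with False show ?thesis
      by simp
  qed
  also have "\<dots> \<longleftrightarrow> p mod 4 = 1"
    using p_eq by presburger
  finally show ?thesis
    using QR by simp
qed

section \<open>Blocks in sequences of length 6 and 9\<close>

lemma block_of_6:
  assumes p: "p mod 4 = 1" and xs: "length xs = 6" "set xs \<subseteq> {0..<p}"
  shows "\<exists>ys. ys \<noteq> [] \<and> sublist ys xs \<and> square_zero_sum (mset ys)"
proof -
  obtain x1 x2 x3 x4 x5 x6 where xs_eq: "xs = [x1, x2, x3, x4, x5, x6]"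
    using xs(1) by (auto simp: numeral_eq_Suc length_Suc_conv)
  have sub: "sublist [x1, x2] xs" "sublist [x3, x4] xs" "sublist [x5, x6] xs"
    unfolding xs_eq by (simp_all add: sublist_code)
  \<comment> \<open>\<open>card Q = 4\<close> would mean \<open>p = 9\<close>, so the only prime
    here below the range of \<open>two_triples\<close> is 5.\<close>
  have "p \<noteq> 9"
    using prime by (auto simp: prime_int_iff dest!: spec[of _ 3])
  then have "p = 5 \<or> 5 \<le> card Q"
    using p p_eq gt_2 by presburger
  then consider "x1 = x2 \<or> x3 = x4 \<or> x5 = x6" | "p = 5"
    | "x1 \<noteq> x2" "x3 \<noteq> x4" "x5 \<noteq> x6" "5 \<le> card Q"
    by blast
  then show ?thesis
  proof cases
    case 1
    then show ?thesis
      using sub square_zero_sum_pair p sq_minus_1_iff by (metis list.distinct(1))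
  next
    case 2
    then show ?thesis
      unfolding xs_eq by (rule block_mod_5)
  next
    case 3
    then have "square_zero_sum (mset xs)"
      using square_zero_sum_length_6[OF _ xs(2)[unfolded xs_eq]] unfolding xs_eq by blast
    then show ?thesis
      unfolding xs_eq by blast
  qed
qed

lemma block_of_9:
  assumes p: "p mod 4 = 3" and xs: "length xs = 9" "set xs \<subseteq> {0..<p}"
  shows "\<exists>ys. ys \<noteq> [] \<and> sublist ys xs \<and> square_zero_sum (mset ys)"
proof -
  obtain x1 x2 x3 x4 x5 x6 x7 x8 x9 where xs_eq: "xs = [x1, x2, x3, x4, x5, x6, x7, x8, x9]"
    using xs(1) by (auto simp: numeral_eq_Suc length_Suc_conv)
  have sub: "sublist [x1, x2, x3] xs" "sublist [x4, x5, x6] xs" "sublist [x7, x8, x9] xs"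
    unfolding xs_eq by (simp_all add: sublist_code)
  have p_cases: "p = 3 \<or> p = 7 \<or> 5 \<le> card Q"
    using p p_eq gt_2 by presburger
  show ?thesis
  proof (cases "p = 3")
    case True
    from this xs(1) show ?thesis
      by (rule block_mod_3)
  next
    case p3: False
    have q3: "3 \<le> card Q"
      using p3 p_cases p_eq by linarith
    \<comment> \<open>A constant triple is itself a block. Otherwise a value of multiplicity three
      lets all nine terms be used, and multiplicities at most two leave \<open>p = 7\<close> or
      \<open>5 \<le> card Q\<close>.\<close>
    consider "x1 = x2 \<and> x2 = x3" | "x4 = x5 \<and> x5 = x6" | "x7 = x8 \<and> x8 = x9"
      | u where "3 \<le> count (mset xs) u"
        "\<not> (x1 = x2 \<and> x2 = x3)" "\<not> (x4 = x5 \<and> x5 = x6)" "\<not> (x7 = x8 \<and> x8 = x9)"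
      | "p = 7" "\<forall>u. \<not> 3 \<le> count (mset xs) u"
      | "5 \<le> card Q" "\<forall>u. \<not> 3 \<le> count (mset xs) u"
      using p3 p_cases by blast
    then show ?thesis
    proof cases
      case 1
      then have "square_zero_sum (mset [x1, x2, x3])"
        using square_zero_sum_triple[OF q3, of x1] by simp
      then show ?thesis
        using sub(1) by blast
    next
      case 2
      then have "square_zero_sum (mset [x4, x5, x6])"
        using square_zero_sum_triple[OF q3, of x4] by simp
      then show ?thesis
        using sub(2) by blast
    next
      case 3
      then have "square_zero_sum (mset [x7, x8, x9])"
        using square_zero_sum_triple[OF q3, of x7] by simp
      then show ?thesis
        using sub(3) by blast
    next
      case 4
      have "square_zero_sum (mset xs)"
        unfolding xs_eq by (rule square_zero_sum_length_9[OF q3 _ 4(1)[unfolded xs_eq] 4(2-4)])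
          (use xs(2) in \<open>simp only: xs_eq\<close>)
      moreover have "xs \<noteq> []"
        using xs(1) by auto
      ultimately show ?thesis
        by blast
    next
      case 5
      have "square_zero_sum (mset xs)"
      proof (rule square_zero_sum_mod_7[OF 5(1)])
        fix u show "count (mset xs) u \<le> 2"
          using spec[OF 5(2), of u] by linarith
      qed (use xs in \<open>simp_all only: size_mset set_mset_mset\<close>)
      moreover have "xs \<noteq> []"
        using xs(1) by auto
      ultimately show ?thesis
        by blast
    next
      case 6
      \<comment> \<open>When no value occurs three times, the first six terms already
        suffice.\<close>
      have "square_zero_sum (mset (take 6 xs))"
      proof (rule square_zero_sum_of_small_multiplicities[OF 6(1)])
        fix u
        have "mset (take 6 xs) \<subseteq># mset xs"
          by (metis append_take_drop_id mset_append mset_subset_eq_add_left)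
        then have "count (mset (take 6 xs)) u \<le> count (mset xs) u"
          by (rule mset_subset_eq_count)
        then show "count (mset (take 6 xs)) u \<le> 2"
          using spec[OF 6(2), of u] by linarith
      next
        show "set (take 6 xs) \<subseteq> {0..<p}"
          using xs(2) set_take_subset by (rule order.trans[rotated])
      qed (use xs(1) in simp)
      moreover have "take 6 xs \<noteq> []"
        using xs(1) by auto
      ultimately show ?thesis
        using sublist_take by blast
    qed
  qed
qed

end

subsection \<open>The constant\<close>

text \<open>One sequence of length \<open>n - 1\<close> without a suitable block excludes every
  smaller length, because its prefixes have no suitable block either.\<close>

lemma C_const_eqI:
  assumes "0 < n"
    and "\<And>xs. length xs = n \<Longrightarrow> set xs \<subseteq> carrier (Zp p) \<Longrightarrow>
      \<exists>ys. ys \<noteq> [] \<and> sublist ys xs \<and> weighted_zero_sum p A B ys"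
    and xs: "Suc (length xs) = n" "set xs \<subseteq> carrier (Zp p)"
    and avoids: "\<And>ys. ys \<noteq> [] \<Longrightarrow> sublist ys xs \<Longrightarrow> \<not> weighted_zero_sum p A B ys"
  shows "C_const p A B = enat n"
  unfolding C_const_def
proof (rule antisym)
  let ?S = "{enat k | k. 0 < k \<and> (\<forall>xs. length xs = k \<and> set xs \<subseteq> carrier (Zp p) \<longrightarrow>
    (\<exists>ys. ys \<noteq> [] \<and> sublist ys xs \<and> weighted_zero_sum p A B ys))}"
  show "Inf ?S \<le> enat n"
    using assms(1,2) by (intro Inf_lower) blast
  show "enat n \<le> Inf ?S"
  proof (rule Inf_greatest)
    fix s assume "s \<in> ?S"
    then obtain k where s: "s = enat k" and k: "\<And>xs. length xs = k \<Longrightarrow> set xs \<subseteq> carrier (Zp p) \<Longrightarrow>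
        \<exists>ys. ys \<noteq> [] \<and> sublist ys xs \<and> weighted_zero_sum p A B ys"
      by blast
    have "n \<le> k"
    proof (rule ccontr)
      assume "\<not> n \<le> k"
      then have "length (take k xs) = k"
        using xs(1) by simp
      moreover have "set (take k xs) \<subseteq> carrier (Zp p)"
        using xs(2) set_take_subset by fast
      ultimately obtain ys where "ys \<noteq> []" "sublist ys (take k xs)" "weighted_zero_sum p A B ys"
        using k by blast
      then show False
        using avoids sublist_order.order.trans[OF _ sublist_take] by blast
    qed
    then show "enat n \<le> s"
      by (simp add: s)
  qed
qed

section \<open>Transfer from the residue ring to divisibility, and the two values\<close>

locale odd_prime_nat =
  fixes p :: nat
  assumes prime_p: "prime p" and odd_p: "odd p"
begin

sublocale odd_prime_mod "int p"
proof
  show "prime (int p)"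
    using prime_p by simp
  have "p \<noteq> 2"
    using odd_p by auto
  then show "2 < int p"
    using prime_ge_2_nat[OF prime_p] by simp
qed

sublocale residues_prime p "Zp p"
  by unfold_locales (rule prime_p)

lemma carrier_eq: "carrier (Zp p) = {0..<int p}"
  by (auto simp: res_carrier_eq)

lemma unit_squares_eq: "unit_squares p = Q"
proof (intro equalityI subsetI)
  fix a assume "a \<in> unit_squares p"
  then obtain x where x: "x \<in> Units (Zp p)" "a = x [^]\<^bsub>Zp p\<^esub> (2::nat)"
    unfolding unit_squares_def by blast
  have "0 < x" "x < int p" "\<not> int p dvd x"
    using x(1) unfolding res_units_eq p_coprime_right_int by blast+
  moreover from this have "a = x\<^sup>2 mod int p"
    using x(2) pow_cong[of x 2] by simp
  ultimately show "a \<in> Q"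
    unfolding Q_def sq_def using gt_2 by (auto simp: cong_def)
next
  fix a assume "a \<in> Q"
  then obtain y where y: "0 \<le> a" "a < int p" "\<not> int p dvd y" "[a = y\<^sup>2] (mod int p)"
    by (auto simp: Q_def sq_def)
  have "a = (y mod int p) [^]\<^bsub>Zp p\<^esub> (2::nat)"
    unfolding pow_cong using y(1,2,4) by (simp add: cong_def)
  moreover have "y mod int p \<in> Units (Zp p)"
    using y(3) gt_2 by (intro mod_in_res_units) (simp_all add: p_coprime_right_int)
  ultimately show "a \<in> unit_squares p"
    unfolding unit_squares_def by blast
qed

lemma sum_eq_zero_iff:
  fixes n :: nat
  shows "(\<Oplus>\<^bsub>Zp p\<^esub>i\<in>{..<n}. f i \<otimes>\<^bsub>Zp p\<^esub> g i) = \<zero>\<^bsub>Zp p\<^esub> \<longleftrightarrow> int p dvd (\<Sum>i<n. f i * g i)"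
  unfolding res_mult_eq res_zero_eq dvd_eq_mod_eq_0
  by (subst residues.sum_cong[OF residues_axioms]) simp_all

text \<open>With all \<open>bs\<close> equal to one \<open>b\<close>, the second sum is
  \<open>b\<close> times the total weight. The weights are reduced modulo \<open>p\<close> to lie in
  \<open>unit_squares p\<close>.\<close>

lemma weighted_zero_sum_of_square_zero_sum:
  assumes "square_zero_sum (mset xs)" "B \<noteq> {}"
  shows "weighted_zero_sum p (unit_squares p) B xs"
proof -
  obtain b where "b \<in> B"
    using assms(2) by blast
  obtain as where as: "length as = length xs" "\<forall>a\<in>set as. sq a"
    "int p dvd (\<Sum>i<length xs. as ! i)" "int p dvd (\<Sum>i<length xs. as ! i * xs ! i)"
    using square_zero_sum_mset_weights assms(1) by blast
  define as' where "as' = map (\<lambda>a. a mod int p) as"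
  define bs where "bs = replicate (length xs) b"
  have "[(\<Sum>i<length xs. as' ! i * xs ! i) = (\<Sum>i<length xs. as ! i * xs ! i)] (mod int p)"
    by (rule cong_sum) (simp add: as'_def as(1) cong_def mod_mult_left_eq)
  then have 1: "int p dvd (\<Sum>i<length xs. as' ! i * xs ! i)"
    using as(4) cong_dvd_iff by blast
  have "[(\<Sum>i<length xs. bs ! i * as' ! i) = (\<Sum>i<length xs. b * as ! i)] (mod int p)"
    by (rule cong_sum) (simp add: as'_def bs_def as(1) cong_def mod_mult_right_eq)
  moreover have "int p dvd (\<Sum>i<length xs. b * as ! i)"
    using as(3) by (simp flip: sum_distrib_left)
  ultimately have 2: "int p dvd (\<Sum>i<length xs. bs ! i * as' ! i)"
    using cong_dvd_iff by blast
  have "set as' \<subseteq> unit_squares p" "set bs \<subseteq> B" "length as' = length xs" "length bs = length xs"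
    using as \<open>b \<in> B\<close> gt_2 by (auto simp: as'_def bs_def unit_squares_eq Q_def)
  then show ?thesis
    unfolding weighted_zero_sum_def sum_eq_zero_iff using 1 2 by blast
qed

text \<open>Sums over \<open>zip\<close> let the simplifier evaluate the conditions on the explicit
  short blocks of the lower bounds.\<close>

lemma weighted_zero_sumE:
  assumes "weighted_zero_sum p (unit_squares p) B xs"
  obtains as bs where "length as = length xs" "length bs = length xs"
    "\<forall>a\<in>set as. sq a" "set bs \<subseteq> B"
    "int p dvd (\<Sum>(a, x)\<leftarrow>zip as xs. a * x)" "int p dvd (\<Sum>(b, a)\<leftarrow>zip bs as. b * a)"
proof -
  have zip: "(\<Sum>i<length xs. f ! i * g ! i) = (\<Sum>(a, x)\<leftarrow>zip f g. a * x)"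
    if "length f = length xs" "length g = length xs" for f g :: "int list"
    using that by (simp add: sum_list_sum_nth atLeast0LessThan)
  obtain as bs where *: "length as = length xs" "length bs = length xs"
    "set as \<subseteq> unit_squares p" "set bs \<subseteq> B" "int p dvd (\<Sum>i<length xs. as ! i * xs ! i)"
    "int p dvd (\<Sum>i<length xs. bs ! i * as ! i)"
    using assms unfolding weighted_zero_sum_def sum_eq_zero_iff by blast
  show ?thesis
    by (rule that[OF *(1,2)]) (use * in \<open>auto simp: zip unit_squares_eq Q_def\<close>)
qed

text \<open>For the lower bound, a block of \<open>[0, 1, 0, g, 0]\<close> with just one nonzero
  term has a nonzero first sum; with both, \<open>g\<close> would be minus a quotient of squares,
  hence a square. A block of zeros is a single zero, and its second sum is a product of two nonzero
  residues.\<close>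

lemma C_const_1_mod_4:
  assumes p: "p mod 4 = 1" and B: "B \<noteq> {}" "B \<subseteq> carrier (Zp p)" "0 \<notin> B"
  shows "C_const p (unit_squares p) B = enat 6"
proof -
  have p': "int p mod 4 = 1"
    using p by presburger
  then have minus_1: "sq (- 1)"
    by (simp add: sq_minus_1_iff)
  \<comment> \<open>Squares are half of the nonzero residues, so a nonresidue \<open>g\<close>
    exists.\<close>
  have "card Q < card {1..<int p}"
    using p_eq gt_2 by simp
  then have "\<not> {1..<int p} \<subseteq> Q"
    by (meson card_mono finite_Q not_less)
  then obtain g where "g \<in> {1..<int p}" "g \<notin> Q"
    by blast
  then have g: "g \<in> {1..<int p}" "\<not> sq g"
    by (simp_all add: Q_def)
  have nd_g: "\<not> int p dvd g"
    using g(1) zdvd_not_zless by auto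
  have nd_B: "\<not> int p dvd b" if "b \<in> B" for b
    using that B zdvd_not_zless[of b "int p"] by (force simp: carrier_eq)
  have nd: "\<not> int p dvd a + b * g" if "sq a" "sq b" for a b
  proof
    assume "int p dvd a + b * g"
    then have "[b * g = - 1 * a] (mod int p)"
      by (simp add: cong_iff_dvd_diff add.commute)
    then have "sq (b * g)"
      using sq_mult[OF minus_1 that(1)] sq_cong by blast
    then show False
      using sq_cancel that(2) g(2) by blast
  qed
  show ?thesis
  proof (rule C_const_eqI)
    fix xs assume "length xs = 6" "set xs \<subseteq> carrier (Zp p)"
    then obtain ys where "ys \<noteq> []" "sublist ys xs" "square_zero_sum (mset ys)"
      using block_of_6[OF p', of xs] by (auto simp: carrier_eq)
    then show "\<exists>ys. ys \<noteq> [] \<and> sublist ys xs \<and> weighted_zero_sum p (unit_squares p) B ys"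
      using weighted_zero_sum_of_square_zero_sum B(1) by blast
  next
    fix ys assume ys: "ys \<noteq> []" "sublist ys [0, 1, 0, g, 0]"
    show "\<not> weighted_zero_sum p (unit_squares p) B ys"
    proof
      assume "weighted_zero_sum p (unit_squares p) B ys"
      then obtain as bs where *: "length as = length ys" "length bs = length ys"
        "\<forall>a\<in>set as. sq a" "set bs \<subseteq> B"
        "int p dvd (\<Sum>(a, x)\<leftarrow>zip as ys. a * x)" "int p dvd (\<Sum>(b, a)\<leftarrow>zip bs as. b * a)"
        by (rule weighted_zero_sumE)
      have "ys \<in> {[0], [1], [g], [0, 1], [1, 0], [0, g], [g, 0], [0, 1, 0], [1, 0, g], [0, g, 0],
          [0, 1, 0, g], [1, 0, g, 0], [0, 1, 0, g, 0]}"
        using ys by (auto simp: sublist_Cons_right prefix_Cons)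
      then show False
        using * nd nd_g nd_B sq_not_dvd
        by (elim insertE emptyE) (auto simp: length_Suc_conv dvd_mult_iff)
    qed
  qed (use g gt_2 in \<open>auto simp: carrier_eq\<close>)
qed

text \<open>Since \<open>- 1\<close> is not a square, two squares never sum to zero. In
  \<open>[0, 0, 1, 0, 0, 1, 0, 0]\<close> this excludes blocks with both ones, through the first
  sum, and the block \<open>[0, 0]\<close>, through the second, whose summands are squares because
  \<open>B\<close> consists of squares.\<close>

lemma C_const_3_mod_4:
  assumes p: "p mod 4 = 3" and B: "B \<noteq> {}" "B \<subseteq> unit_squares p"
  shows "C_const p (unit_squares p) B = enat 9"
proof -
  have p': "int p mod 4 = 3"
    using p by presburger
  then have minus_1: "\<not> sq (- 1)"
    by (simp add: sq_minus_1_iff)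
  have sq_B: "sq b" if "b \<in> B" for b
    using that B(2) by (auto simp: unit_squares_eq Q_def)
  have nd: "\<not> int p dvd a + b" if "sq a" "sq b" for a b
  proof
    assume "int p dvd a + b"
    then have "[a * - 1 = b] (mod int p)"
      using dvd_minus_iff[of "int p" "a + b"] by (simp add: cong_iff_dvd_diff)
    then have "sq (a * - 1)"
      using that(2) sq_cong by blast
    then show False
      using sq_cancel that(1) minus_1 by blast
  qed
  show ?thesis
  proof (rule C_const_eqI)
    fix xs assume "length xs = 9" "set xs \<subseteq> carrier (Zp p)"
    then obtain ys where "ys \<noteq> []" "sublist ys xs" "square_zero_sum (mset ys)"
      using block_of_9[OF p', of xs] by (auto simp: carrier_eq)
    then show "\<exists>ys. ys \<noteq> [] \<and> sublist ys xs \<and> weighted_zero_sum p (unit_squares p) B ys"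
      using weighted_zero_sum_of_square_zero_sum B(1) by blast
  next
    fix ys :: "int list" assume ys: "ys \<noteq> []" "sublist ys [0, 0, 1, 0, 0, 1, 0, 0]"
    show "\<not> weighted_zero_sum p (unit_squares p) B ys"
    proof
      assume "weighted_zero_sum p (unit_squares p) B ys"
      then obtain as bs where *: "length as = length ys" "length bs = length ys"
        "\<forall>a\<in>set as. sq a" "set bs \<subseteq> B"
        "int p dvd (\<Sum>(a, x)\<leftarrow>zip as ys. a * x)" "int p dvd (\<Sum>(b, a)\<leftarrow>zip bs as. b * a)"
        by (rule weighted_zero_sumE)
      have "ys \<in> {[0], [1], [0, 0], [0, 1], [1, 0], [0, 0, 1], [0, 1, 0], [1, 0, 0],
          [0, 0, 1, 0], [0, 1, 0, 0], [1, 0, 0, 1], [0, 0, 1, 0, 0], [0, 1, 0, 0, 1], [1, 0, 0, 1, 0],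
          [0, 0, 1, 0, 0, 1], [0, 1, 0, 0, 1, 0], [1, 0, 0, 1, 0, 0],
          [0, 0, 1, 0, 0, 1, 0], [0, 1, 0, 0, 1, 0, 0], [0, 0, 1, 0, 0, 1, 0, 0]}"
        using ys by (auto simp: sublist_Cons_right prefix_Cons)
      then show False
        using * nd sq_not_dvd sq_B sq_mult
        by (elim insertE emptyE) (auto simp: length_Suc_conv dvd_mult_iff)
    qed
  qed (use gt_2 in \<open>auto simp: carrier_eq\<close>)
qed

end

theorem theorem5p4:
  fixes p :: nat and B :: "int set"
  assumes "prime p" and "odd p"
    and "B \<noteq> {}" and "B \<subseteq> carrier (Zp p)"
  shows "([p = 1] (mod 4) \<and> \<zero>\<^bsub>Zp p\<^esub> \<notin> B \<longrightarrow> C_const p (unit_squares p) B = 6) \<and>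
         ([p = 3] (mod 4) \<and> B \<subseteq> unit_squares p \<longrightarrow> C_const p (unit_squares p) B = 9)"
proof -
  interpret odd_prime_nat p
    using assms(1,2) by unfold_locales
  show ?thesis
    using C_const_1_mod_4[of B] C_const_3_mod_4[of B] assms(3,4)
    by (auto simp: cong_def res_zero_eq numeral_eq_enat)
qed

end
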